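(* Let $s\geq5$, let $c_1,\dots,c_s\in\mathbb{Z}\setminus\{0\}$, and suppose that there exists a non-empty set $I\subset\{1,\dots,s\}$ with $\sum_{i\in I}c_i=0$. Let $r$ be a positive integer. Then there exist constants $N_0,\eta,\delta>0$, depending only on $c_1,\dots,c_s$ and $r$, such that for every positive integer $N$ and every Sidon set $S\subset[N]$ at least one of the following holds: (i) $N\leq N_0$; (ii) $\left||S|-N^{1/2}\right|\geq\eta N^{1/2}$; (iii) for every $r$-colouring $S=C_1\cup\dots\cup C_r$ there exists $j\in\{1,\dots,r\}$ such that $$\sum_{c_1x_1+\dots+c_sx_s=0}1_{C_j}(x_1)\cdots1_{C_j}(x_s)\geq\delta|S|^sN^{-1}.$$
   Context: $[N]=\{1,2,\dots,N\}$. A set $S\subset\mathbb{Z}$ is Sidon if every non-zero integer $x$ has at most one representation $x=s_1-s_2$ with $s_1,s_2\in S$. An $r$-colouring of $S$ is a partition of $S$ into $r$ (possibly empty) classes $C_1,\dots,C_r$. The sum is over all $(x_1,\dots,x_s)\in\mathbb{Z}^s$ with $c_1x_1+\dots+c_sx_s=0$; $1_A$ is the indicator function of $A$. *)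

theory Defs
  imports "HOL-Analysis.Infinite_Sum" "HOL-Library.Disjoint_Sets" "HOL-Library.FuncSet"
begin

definition sidon :: "int set \<Rightarrow> bool" where
  "sidon S \<longleftrightarrow> (\<forall>x. x \<noteq> 0 \<longrightarrow> (\<exists>\<^sub>\<le>\<^sub>1 (s\<^sub>1, s\<^sub>2). s\<^sub>1 \<in> S \<and> s\<^sub>2 \<in> S \<and> x = s\<^sub>1 - s\<^sub>2))"

definition colouring :: "nat \<Rightarrow> (nat \<Rightarrow> int set) \<Rightarrow> int set \<Rightarrow> bool" where
  "colouring r C S \<longleftrightarrow> disjoint_family_on C {1..r} \<and> S = (\<Union>j\<in>{1..r}. C j)"

(* An s-tuple of integers is a function on nat that is undefined outside {1..s}, so
   that each tuple is represented exactly once. *)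
definition solutions :: "nat \<Rightarrow> (nat \<Rightarrow> int) \<Rightarrow> (nat \<Rightarrow> int) set" where
  "solutions s c = {x \<in> {1..s} \<rightarrow>\<^sub>E UNIV. (\<Sum>i=1..s. c i * x i) = 0}"

(* The range of summation is infinite, hence infsum rather than sum (which would be 0).
   For finite A and s > 0 only finitely many terms are non-zero. *)
definition solution_sum :: "nat \<Rightarrow> (nat \<Rightarrow> int) \<Rightarrow> int set \<Rightarrow> real" where
  "solution_sum s c A = (\<Sum>\<^sub>\<infinity>x\<in>solutions s c. \<Prod>i=1..s. indicator A (x i))"

end

theory Submission
  imports Defs "HOL-Library.Real_Mod"
begin

text \<open>
  The argument is a transference principle. Let \<open>n\<close> be the square root of \<open>N\<close>. For a colour class
  \<open>C\<close> of \<open>S\<close>, average its indicator function over a Bohr set \<open>B\<close> on which the characters at all large Fourier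
  coefficients of the colour classes are close to 1. A Sidon set has small additive energy, so the
  Fourier transforms are bounded in \<open>L\<^sup>4\<close>; hence the large spectrum has bounded size, \<open>B\<close> has
  positive density, and, as \<open>s \<ge> 5\<close>, replacing \<open>C\<close> by its average hardly changes the number of solutions.
  By the Erdos-Turan argument the average of a nearly extremal Sidon set over \<open>B\<close> is close to the constant
  \<open>1 / n\<close> in mean square. So almost every point of \<open>[N]\<close> gets average at least \<open>1 / (2 r n)\<close> from some
  colour class, which gives a colouring of almost all of \<open>[N]\<close>, and it remains to count monochromatic solutions there.

  For this count, van der Waerden's theorem yields, in a generic system of \<open>r + s + 1\<close> integers, combinations
  \<open>e\<^sub>0, e\<^sub>1, \<dots>\<close> such that each line \<open>C e\<^sub>i + \<Sum>\<^sub>k\<^sub>>\<^sub>i m\<^sub>k e\<^sub>k\<close> with small \<open>m\<^sub>k\<close> is monochromatic.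
  Two of the first \<open>r + 1\<close> lines have the same colour; they contain a solution with enough free
  parameters for a positive proportion of all solutions to be monochromatic.
\<close>

section \<open>Van der Waerden's theorem\<close>

text \<open>Colourings are total on \<open>nat\<close>; the finitary content lies in the bounds on
  \<open>a\<close> and \<open>d\<close>, which are uniform in the colouring.\<close>

definition vdw :: "nat \<Rightarrow> nat \<Rightarrow> nat \<Rightarrow> bool" where
  "vdw k r W \<longleftrightarrow> (\<forall>\<chi>::nat \<Rightarrow> nat. (\<forall>x. \<chi> x < r) \<longrightarrow>
     (\<exists>a d. 0 < d \<and> a \<le> W \<and> d \<le> W \<and> (\<forall>t<k. \<chi> (a + t * d) = \<chi> a)))"

text \<open>Product arguments use lists or functions as colours, each recording the colouring of a
  whole block. Numbering the finite set \<open>Col\<close> reduces them to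
  \<open>vdw\<close>.\<close>

lemma vdw_finite_colours:
  fixes \<chi> :: "nat \<Rightarrow> 'c"
  assumes "vdw k (card Col) W" "finite Col" "\<And>x. \<chi> x \<in> Col"
  obtains a d where "0 < d" "a \<le> W" "d \<le> W" "\<And>t. t < k \<Longrightarrow> \<chi> (a + t * d) = \<chi> a"
proof -
  obtain f :: "'c \<Rightarrow> nat" where f: "f ` Col = {..<card Col}" "inj_on f Col"
    using ex_bij_betw_finite_nat[OF assms(2)] by (auto simp: bij_betw_def atLeast0LessThan)
  have "\<forall>x. (f \<circ> \<chi>) x < card Col" using f assms(3) by auto
  then obtain a d where ad: "0 < d" "a \<le> W" "d \<le> W" "\<forall>t<k. (f \<circ> \<chi>) (a + t * d) = (f \<circ> \<chi>) a"
    using assms(1) unfolding vdw_def by blast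
  have "\<chi> (a + t * d) = \<chi> a" if "t < k" for t
    using ad(4) that f(2) assms(3) by (auto dest: inj_onD)
  with ad(1-3) show ?thesis by (intro that)
qed

text \<open>Colour focusing: \<open>m\<close> monochromatic progressions of length \<open>k\<close>, of distinct colours,
  that all have \<open>f\<close> as their next term.\<close>
definition focused :: "nat \<Rightarrow> nat \<Rightarrow> nat \<Rightarrow> (nat \<Rightarrow> nat) \<Rightarrow> bool" where
  "focused k m W \<chi> \<longleftrightarrow> (\<exists>f d col. f < W \<and> inj_on col {..<m} \<and>
     (\<forall>i<m. 0 < d i \<and> k * d i \<le> f \<and> (\<forall>t\<in>{1..k}. \<chi> (f - t * d i) = col i)))"

text \<open>Cut \<open>nat\<close> into blocks of length \<open>W\<close> and use the pattern of a
  block as its colour. A progression of \<open>k\<close> equal blocks with difference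
  \<open>e\<close> turns each focused progression in a block into one with difference enlarged by
  \<open>e * W\<close>, and the copies of the focus form one more.\<close>

lemma focused_step:
  fixes \<chi> :: "nat \<Rightarrow> nat"
  assumes W: "\<And>\<chi>'. (\<forall>x. \<chi>' x < r) \<Longrightarrow>
      (\<exists>a d. 0 < d \<and> a + k * d < W \<and> (\<forall>t\<le>k. \<chi>' (a + t * d) = \<chi>' a)) \<or> focused k m W \<chi>'"
    and V: "vdw k (card {xs. set xs \<subseteq> {..<r} \<and> length xs = W}) V"
    and k: "k > 0" and \<chi>: "\<forall>x. \<chi> x < r"
  shows "(\<exists>a d. 0 < d \<and> a + k * d < (V + k * V + 1) * W \<and> (\<forall>t\<le>k. \<chi> (a + t * d) = \<chi> a)) \<or>
         focused k (Suc m) ((V + k * V + 1) * W) \<chi>"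
proof -
  define blk where "blk b = map (\<lambda>x. \<chi> (b * W + x)) [0..<W]" for b
  obtain b e where be: "0 < e" "b \<le> V" "e \<le> V" "\<And>t. t < k \<Longrightarrow> blk (b + t * e) = blk b"
    by (rule vdw_finite_colours[OF V, of blk])
       (use \<chi> in \<open>auto simp: blk_def intro: finite_lists_length_eq\<close>)
  have blk: "\<chi> ((b + t * e) * W + x) = \<chi> (b * W + x)" if "t < k" "x < W" for t x
  proof -
    have "blk (b + t * e) ! x = blk b ! x" using be(4)[OF that(1)] by simp
    then show ?thesis using that(2) by (simp add: blk_def)
  qed
  have "k * e \<le> k * V" using be(3) by simp
  then have bound: "b + k * e + 1 \<le> V + k * V + 1" using be(2) by linarith
  have bound': "(b + k * e) * W + x < (V + k * V + 1) * W" if "x < W" for x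
  proof -
    have "(b + k * e) * W + x < (b + k * e + 1) * W" using that by simp
    also have "\<dots> \<le> (V + k * V + 1) * W" using bound by (rule mult_le_mono1)
    finally show ?thesis .
  qed
  have bound0: "b * W + x < (V + k * V + 1) * W" if "x < W" for x
    using bound'[OF that] by (simp add: algebra_simps)
  define \<chi>' where "\<chi>' x = \<chi> (b * W + x)" for x
  have "\<forall>x. \<chi>' x < r" using \<chi> by (simp add: \<chi>'_def)
  from W[OF this] show ?thesis
  proof
    assume "\<exists>a d. 0 < d \<and> a + k * d < W \<and> (\<forall>t\<le>k. \<chi>' (a + t * d) = \<chi>' a)"
    then obtain a d where ad: "0 < d" "a + k * d < W" "\<forall>t\<le>k. \<chi>' (a + t * d) = \<chi>' a" by blast
    have "b * W + a + k * d < (V + k * V + 1) * W" using bound0[OF ad(2)] by simp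
    moreover have "\<forall>t\<le>k. \<chi> (b * W + a + t * d) = \<chi> (b * W + a)"
      using ad(3) by (simp add: \<chi>'_def add.assoc)
    ultimately show ?thesis using ad(1) by blast
  next
    assume "focused k m W \<chi>'"
    then obtain f d col where f: "f < W" "inj_on col {..<m}"
      and d: "\<And>i. i < m \<Longrightarrow> 0 < d i" "\<And>i. i < m \<Longrightarrow> k * d i \<le> f"
      and col: "\<And>i t. i < m \<Longrightarrow> t \<in> {1..k} \<Longrightarrow> \<chi>' (f - t * d i) = col i"
      unfolding focused_def by blast
    show ?thesis
    \<comment> \<open>If the focus inside the block has the colour of one of the progressions, it
      prolongs that progression to \<open>k + 1\<close> terms. Otherwise its colour is new.\<close>
    proof (cases "\<exists>i<m. col i = \<chi>' f")
      case True
      then obtain i where i: "i < m" "col i = \<chi>' f" by blast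
      have eq: "\<chi>' (f - t * d i) = \<chi>' f" if "t \<le> k" for t
        using col[OF i(1), of t] i(2) that by (cases "t = 0") auto
      define a where "a = f - k * d i"
      have a: "\<chi>' (a + t * d i) = \<chi>' a" if "t \<le> k" for t
      proof -
        have "a + t * d i = f - (k - t) * d i"
          using d(2)[OF i(1)] that by (simp add: a_def diff_mult_distrib)
        then show ?thesis using eq[of "k - t"] eq[of k] that by (simp add: a_def)
      qed
      have "a + k * d i = f" using d(2)[OF i(1)] by (simp add: a_def)
      then have "b * W + a + k * d i < (V + k * V + 1) * W" using bound0[OF f(1)] by simp
      moreover have "\<forall>t\<le>k. \<chi> (b * W + a + t * d i) = \<chi> (b * W + a)"
        using a by (simp add: \<chi>'_def add.assoc)
      ultimately show ?thesis using d(1)[OF i(1)] by blast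
    next
      case False
      \<comment> \<open>The new focus lies in block \<open>b + k * e\<close>, about which nothing is
        known. The points \<open>F - t * D i\<close> with \<open>t\<close> at least 1 lie in the
        equal blocks; for \<open>i = m\<close> they are the copies of \<open>f\<close>.\<close>
      define F where "F = (b + k * e) * W + f"
      define D where "D i = (if i < m then d i else 0) + e * W" for i
      define Col where "Col i = (if i < m then col i else \<chi>' f)" for i
      have W0: "W > 0" using f by simp
      have "inj_on Col {..<Suc m}"
        using f(2) False by (auto simp: inj_on_def Col_def less_Suc_eq)
      moreover have "F < (V + k * V + 1) * W" unfolding F_def using bound'[OF f(1)] .
      moreover have "0 < D i \<and> k * D i \<le> F \<and> (\<forall>t\<in>{1..k}. \<chi> (F - t * D i) = Col i)" if "i < Suc m" for i
      proof (intro conjI ballI)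
        show "0 < D i" using be(1) W0 by (simp add: D_def)
        define d' where "d' = (if i < m then d i else 0)"
        have d': "k * d' \<le> f" using d(2) by (simp add: d'_def)
        have D: "D i = d' + e * W" by (simp add: D_def d'_def)
        show "k * D i \<le> F" using d' by (simp add: D F_def algebra_simps)
        fix t assume t: "t \<in> {1..k}"
        have td: "t * d' \<le> f" using d' t by (meson atLeastAtMost_iff le_trans mult_le_mono1)
        obtain q where q: "k = t + q" using t le_Suc_ex by auto
        have "F - t * D i = (b + q * e) * W + (f - t * d')"
          using td by (simp add: F_def D q algebra_simps)
        moreover have "\<chi> \<dots> = \<chi>' (f - t * d')"
          unfolding \<chi>'_def by (rule blk) (use t q f(1) in auto)
        moreover have "\<chi>' (f - t * d') = Col i"
          using that t col by (auto simp: Col_def d'_def)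
        ultimately show "\<chi> (F - t * D i) = Col i" by simp
      qed
      ultimately have "focused k (Suc m) ((V + k * V + 1) * W) \<chi>"
        unfolding focused_def by blast
      then show ?thesis ..
    qed
  qed
qed

lemma focused_exists:
  assumes "\<And>r. \<exists>W. vdw k r W" "k > 0"
  shows "\<exists>W. \<forall>\<chi>. (\<forall>x. \<chi> x < r) \<longrightarrow>
      (\<exists>a d. 0 < d \<and> a + k * d < W \<and> (\<forall>t\<le>k. \<chi> (a + t * d) = \<chi> a)) \<or> focused k m W \<chi>"
proof (induction m)
  case 0
  have "focused k 0 1 \<chi>" for \<chi> by (auto simp: focused_def)
  then show ?case by blast
next
  case (Suc m)
  then obtain W where W: "\<And>\<chi>. (\<forall>x. \<chi> x < r) \<Longrightarrow>
      (\<exists>a d. 0 < d \<and> a + k * d < W \<and> (\<forall>t\<le>k. \<chi> (a + t * d) = \<chi> a)) \<or> focused k m W \<chi>"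
    by blast
  obtain V where V: "vdw k (card {xs. set xs \<subseteq> {..<r} \<and> length xs = W}) V" using assms(1) by blast
  from focused_step[OF W V assms(2)] show ?case by blast
qed

theorem van_der_Waerden: "\<exists>W. vdw k r W"
proof (induction k arbitrary: r)
  case 0
  show ?case unfolding vdw_def by (intro exI[of _ 1]) auto
next
  case (Suc k)
  show ?case
  proof (cases "k = 0")
    case True
    then show ?thesis unfolding vdw_def by (intro exI[of _ 1]) auto
  next
    case False
    then obtain W where W: "\<And>\<chi>. (\<forall>x. \<chi> x < r) \<Longrightarrow>
        (\<exists>a d. 0 < d \<and> a + k * d < W \<and> (\<forall>t\<le>k. \<chi> (a + t * d) = \<chi> a)) \<or> focused k r W \<chi>"
      using focused_exists[OF Suc.IH] by blast
    have "\<exists>a d. 0 < d \<and> a + k * d < W \<and> (\<forall>t\<le>k. \<chi> (a + t * d) = \<chi> a)" if \<chi>: "\<forall>x. \<chi> x < r" for \<chi>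
      using W[OF \<chi>]
    proof
      \<comment> \<open>The \<open>r\<close> distinct colours exhaust all colours, so the focus
        shares the colour of one progression and completes it.\<close>
      assume "focused k r W \<chi>"
      then obtain f d col where f: "f < W" "inj_on col {..<r}"
        and d: "\<And>i. i < r \<Longrightarrow> 0 < d i" "\<And>i. i < r \<Longrightarrow> k * d i \<le> f"
        and col: "\<And>i t. i < r \<Longrightarrow> t \<in> {1..k} \<Longrightarrow> \<chi> (f - t * d i) = col i"
        unfolding focused_def by blast
      have "col ` {..<r} \<subseteq> {..<r}"
      proof (clarify, simp)
        fix i assume "i < r"
        then show "col i < r" using col[of i 1] False \<chi> by (metis One_nat_def atLeastAtMost_iff le_refl less_one linorder_not_le)
      qed
      then have "col ` {..<r} = {..<r}" using f(2) by (simp add: endo_inj_surj)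
      then obtain i where i: "i < r" "col i = \<chi> f" using \<chi> by (metis imageE lessThan_iff)
      have eq: "\<chi> (f - t * d i) = \<chi> f" if "t \<le> k" for t
        using col[OF i(1), of t] i(2) that by (cases "t = 0") auto
      define a where "a = f - k * d i"
      have "\<chi> (a + t * d i) = \<chi> a" if "t \<le> k" for t
      proof -
        have "a + t * d i = f - (k - t) * d i"
          using d(2)[OF i(1)] that by (simp add: a_def diff_mult_distrib)
        then show ?thesis using eq[of "k - t"] eq[of k] that by (simp add: a_def)
      qed
      moreover have "a + k * d i = f" using d(2)[OF i(1)] by (simp add: a_def)
      ultimately show ?thesis using f(1) d(1)[OF i(1)] by blast
    qed
    moreover have "a \<le> W \<and> d \<le> W" if "a + k * d < W" for a d
      using that False by (cases k) auto
    ultimately have "vdw (Suc k) r W" unfolding vdw_def less_Suc_eq_le by meson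
    then show ?thesis by blast
  qed
qed

section \<open>Monochromatic lines\<close>

text \<open>Induction on the dimension: the last coefficient is coloured by the whole pattern that
  the other coefficients see, so van der Waerden gives a progression along which this pattern is
  constant. The progressions run through coefficients, which makes \<open>W\<close> uniform in
  \<open>b\<close> and \<open>z\<close>.\<close>

lemma van_der_Waerden_grid:
  fixes r n L :: nat
  shows "\<exists>W. \<forall>\<chi>::nat \<Rightarrow> nat. (\<forall>x. \<chi> x < r) \<longrightarrow> (\<forall>b z. \<exists>u v.
     (\<forall>i<n. u i \<le> W \<and> 0 < v i \<and> v i \<le> W) \<and>
     (\<forall>t. (\<forall>i<n. t i \<le> L) \<longrightarrow>
        \<chi> (b + (\<Sum>i<n. (u i + v i * t i) * z i)) = \<chi> (b + (\<Sum>i<n. u i * z i))))"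
proof (induction n)
  case 0
  show ?case by auto
next
  case (Suc n)
  then obtain W where W: "\<forall>\<chi>::nat \<Rightarrow> nat. (\<forall>x. \<chi> x < r) \<longrightarrow> (\<forall>b z. \<exists>u v.
     (\<forall>i<n. u i \<le> W \<and> 0 < v i \<and> v i \<le> W) \<and>
     (\<forall>t. (\<forall>i<n. t i \<le> L) \<longrightarrow>
        \<chi> (b + (\<Sum>i<n. (u i + v i * t i) * z i)) = \<chi> (b + (\<Sum>i<n. u i * z i))))" ..
  \<comment> \<open>This box contains every coefficient vector \<open>u i + v i * t i\<close> that
    the induction hypothesis can produce.\<close>
  define F where "F = ({..<n} \<rightarrow>\<^sub>E {..W + W * L})"
  define Col where "Col = (F \<rightarrow>\<^sub>E {..<r})"
  have "finite F" unfolding F_def by (intro finite_PiE) auto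
  then have Col: "finite Col" unfolding Col_def by (intro finite_PiE) auto
  obtain V where V: "vdw (Suc L) (card Col) V" using van_der_Waerden by blast
  show ?case
  proof (intro exI[of _ "W + V"] allI impI)
    fix \<chi> :: "nat \<Rightarrow> nat" and b and z :: "nat \<Rightarrow> nat"
    assume \<chi>: "\<forall>x. \<chi> x < r"
    define \<kappa> where "\<kappa> m = restrict (\<lambda>w. \<chi> (b + m * z n + (\<Sum>i<n. w i * z i))) F" for m
    obtain a d where ad: "0 < d" "a \<le> V" "d \<le> V" "\<And>t. t < Suc L \<Longrightarrow> \<kappa> (a + t * d) = \<kappa> a"
      by (rule vdw_finite_colours[OF V Col, of \<kappa>]) (use \<chi> in \<open>auto simp: \<kappa>_def Col_def\<close>)
    obtain u v where uv: "\<And>i. i < n \<Longrightarrow> u i \<le> W \<and> 0 < v i \<and> v i \<le> W"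
      and mono: "\<And>t. (\<And>i. i < n \<Longrightarrow> t i \<le> L) \<Longrightarrow>
        \<chi> (b + a * z n + (\<Sum>i<n. (u i + v i * t i) * z i)) = \<chi> (b + a * z n + (\<Sum>i<n. u i * z i))"
      using W[THEN spec, THEN mp, OF \<chi>, THEN spec, THEN spec, of "b + a * z n" z] by blast
    define u' where "u' = u(n := a)"
    define v' where "v' = v(n := d)"
    have "\<chi> (b + (\<Sum>i<Suc n. (u' i + v' i * t i) * z i)) = \<chi> (b + (\<Sum>i<Suc n. u' i * z i))"
      if t: "\<forall>i<Suc n. t i \<le> L" for t
    proof -
      define w where "w = restrict (\<lambda>i. u i + v i * t i) {..<n}"
      have "w \<in> F"
        unfolding w_def F_def using uv t by (auto intro!: add_mono mult_mono simp: less_Suc_eq)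
      have sum_w: "(\<Sum>i<n. w i * z i) = (\<Sum>i<n. (u i + v i * t i) * z i)"
        by (simp add: w_def)
      have "\<chi> (b + (\<Sum>i<Suc n. (u' i + v' i * t i) * z i)) = \<kappa> (a + t n * d) w"
        using \<open>w \<in> F\<close> by (simp add: \<kappa>_def sum_w u'_def v'_def algebra_simps)
      also have "\<dots> = \<kappa> a w" using ad(4)[of "t n"] t by (simp add: less_Suc_eq_le)
      also have "\<dots> = \<chi> (b + a * z n + (\<Sum>i<n. (u i + v i * t i) * z i))"
        using \<open>w \<in> F\<close> by (simp add: \<kappa>_def sum_w)
      also have "\<dots> = \<chi> (b + a * z n + (\<Sum>i<n. u i * z i))"
        by (rule mono) (use t in auto)
      also have "\<dots> = \<chi> (b + (\<Sum>i<Suc n. u' i * z i))"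
        by (simp add: u'_def algebra_simps)
      finally show ?thesis .
    qed
    moreover have "\<forall>i<Suc n. u' i \<le> W + V \<and> 0 < v' i \<and> v' i \<le> W + V"
      using uv ad(1-3) by (auto simp: u'_def v'_def less_Suc_eq intro: trans_le_add1)
    ultimately show "\<exists>u v. (\<forall>i<Suc n. u i \<le> W + V \<and> 0 < v i \<and> v i \<le> W + V) \<and>
     (\<forall>t. (\<forall>i<Suc n. t i \<le> L) \<longrightarrow>
        \<chi> (b + (\<Sum>i<Suc n. (u i + v i * t i) * z i)) = \<chi> (b + (\<Sum>i<Suc n. u i * z i)))"
      by blast
  qed
qed

definition lin :: "nat \<Rightarrow> (nat \<Rightarrow> nat \<Rightarrow> nat) \<Rightarrow> (nat \<Rightarrow> nat) \<Rightarrow> nat \<Rightarrow> nat" where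
  "lin n T z i = (\<Sum>k<n. T i k * z k)"

text \<open>Forms with larger index involve only later variables. The bound \<open>B\<close> leaves
  finitely many systems, so that a pigeonhole over all systems is possible.\<close>

definition triangular :: "nat \<Rightarrow> nat \<Rightarrow> (nat \<Rightarrow> nat \<Rightarrow> nat) \<Rightarrow> bool" where
  "triangular n B T \<longleftrightarrow>
     (\<forall>i<n. 0 < T i i \<and> (\<forall>k<n. T i k \<le> B) \<and> (\<forall>k<i. T i k = 0))"

text \<open>A weak form of Deuber's theorem on \<open>(m,p,c)\<close>-sets: different lines may have
  different colours.\<close>
lemma monochromatic_lines:
  assumes C: "0 < C"
  shows "\<exists>B. \<forall>\<chi>::nat \<Rightarrow> nat. (\<forall>x. \<chi> x < r) \<longrightarrow> (\<forall>z. \<exists>T. triangular n B T \<and>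
     (\<forall>i<n. \<forall>m. (\<forall>k<n. m k \<le> p) \<and> (\<forall>k\<le>i. m k = 0) \<longrightarrow>
        \<chi> (C * lin n T z i + (\<Sum>k<n. m k * lin n T z k)) = \<chi> (C * lin n T z i)))"
proof (induction n)
  case 0
  show ?case by (simp add: triangular_def)
next
  case (Suc n)
  then obtain B where B: "\<forall>\<chi>::nat \<Rightarrow> nat. (\<forall>x. \<chi> x < r) \<longrightarrow> (\<forall>z. \<exists>T. triangular n B T \<and>
     (\<forall>i<n. \<forall>m. (\<forall>k<n. m k \<le> p) \<and> (\<forall>k\<le>i. m k = 0) \<longrightarrow>
        \<chi> (C * lin n T z i + (\<Sum>k<n. m k * lin n T z k)) = \<chi> (C * lin n T z i)))" ..
  define L where "L = n * (p * B)"
  obtain W where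
    W: "\<forall>\<chi>::nat \<Rightarrow> nat. (\<forall>x. \<chi> x < r) \<longrightarrow> (\<forall>b z. \<exists>u v.
     (\<forall>i<n. u i \<le> W \<and> 0 < v i \<and> v i \<le> W) \<and>
     (\<forall>t. (\<forall>i<n. t i \<le> L) \<longrightarrow>
        \<chi> (b + (\<Sum>i<n. (u i + v i * t i) * z i)) = \<chi> (b + (\<Sum>i<n. u i * z i))))"
    using van_der_Waerden_grid[of r n L] ..
  show ?case
  proof (intro exI[of _ "1 + W + B * (C * W)"] allI impI)
    fix \<chi> :: "nat \<Rightarrow> nat" and z
    assume \<chi>: "\<forall>x. \<chi> x < r"
    obtain u v where uv: "\<And>i. i < n \<Longrightarrow> u i \<le> W \<and> 0 < v i \<and> v i \<le> W"
      and mono: "\<And>t. (\<And>i. i < n \<Longrightarrow> t i \<le> L) \<Longrightarrow>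
        \<chi> (C * z 0 + (\<Sum>i<n. (u i + v i * t i) * (C * z (Suc i)))) =
        \<chi> (C * z 0 + (\<Sum>i<n. u i * (C * z (Suc i))))"
      using W[THEN spec, THEN mp, OF \<chi>, THEN spec, THEN spec, of "C * z 0" "\<lambda>i. C * z (Suc i)"]
      by blast
    \<comment> \<open>With this rescaling, adding a combination of the later forms to
      \<open>C\<close> times the first form is a move inside the monochromatic grid, whose steps are
      \<open>v k * (C * z (Suc k))\<close>.\<close>
    define z' where "z' k = C * v k * z (Suc k)" for k
    obtain T' where T': "triangular n B T'"
      and line: "\<And>i m. i < n \<Longrightarrow> (\<And>k. k < n \<Longrightarrow> m k \<le> p) \<Longrightarrow> (\<And>k. k \<le> i \<Longrightarrow> m k = 0) \<Longrightarrow>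
        \<chi> (C * lin n T' z' i + (\<Sum>k<n. m k * lin n T' z' k)) = \<chi> (C * lin n T' z' i)"
      using B[THEN spec, THEN mp, OF \<chi>, THEN spec, of z'] by blast
    define T where "T i k = (case i of 0 \<Rightarrow> (case k of 0 \<Rightarrow> 1 | Suc l \<Rightarrow> u l)
      | Suc j \<Rightarrow> (case k of 0 \<Rightarrow> 0 | Suc l \<Rightarrow> T' j l * (C * v l)))" for i k
    have lin0: "lin (Suc n) T z 0 = z 0 + (\<Sum>k<n. u k * z (Suc k))"
      by (simp add: lin_def T_def sum.lessThan_Suc_shift del: sum.lessThan_Suc)
    have linS: "lin (Suc n) T z (Suc i) = lin n T' z' i" for i
      by (simp add: lin_def T_def z'_def sum.lessThan_Suc_shift mult_ac del: sum.lessThan_Suc)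
    have "triangular (Suc n) (1 + W + B * (C * W)) T"
      unfolding triangular_def
    proof (intro allI impI conjI)
      fix i assume i: "i < Suc n"
      show "0 < T i i" using i T' uv C by (auto simp: T_def triangular_def split: nat.splits)
      fix k assume k: "k < Suc n"
      have "T' j l * (C * v l) \<le> B * (C * W)" if "j < n" "l < n" for j l
        using T' uv that by (intro mult_mono) (auto simp: triangular_def)
      then show "T i k \<le> 1 + W + B * (C * W)"
        using i k uv by (auto simp: T_def le_Suc_eq trans_le_add1 trans_le_add2 split: nat.splits)
    next
      fix i k assume "i < Suc n" "k < i"
      then show "T i k = 0" using T' by (auto simp: T_def triangular_def split: nat.splits)
    qed
    moreover have "\<chi> (C * lin (Suc n) T z i + (\<Sum>k<Suc n. m k * lin (Suc n) T z k)) =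
        \<chi> (C * lin (Suc n) T z i)"
      if i: "i < Suc n" and m: "\<forall>k<Suc n. m k \<le> p" "\<forall>k\<le>i. m k = 0" for i m
    proof -
      have tail: "(\<Sum>k<Suc n. m k * lin (Suc n) T z k) = (\<Sum>k<n. m (Suc k) * lin n T' z' k)"
        using m(2) by (simp add: sum.lessThan_Suc_shift linS del: sum.lessThan_Suc)
      show ?thesis
      proof (cases i)
        case (Suc j)
        show ?thesis unfolding tail Suc linS
          by (rule line) (use i m Suc in auto)
      next
        case 0
        \<comment> \<open>\<open>q l\<close> is the total coefficient of \<open>z' l\<close> and
          serves as the grid position \<open>t l\<close>; \<open>L\<close> was chosen as its upper
          bound.\<close>
        define q where "q l = (\<Sum>k<n. m (Suc k) * T' k l)" for l
        have q: "q l \<le> L" if "l < n" for l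
        proof -
          have "q l \<le> (\<Sum>k<n. p * B)" unfolding q_def
            by (intro sum_mono mult_mono) (use m T' that in \<open>auto simp: triangular_def\<close>)
          then show ?thesis by (simp add: L_def)
        qed
        have "(\<Sum>k<n. m (Suc k) * lin n T' z' k) = (\<Sum>k<n. \<Sum>l<n. m (Suc k) * (T' k l * z' l))"
          by (simp add: lin_def sum_distrib_left)
        also have "\<dots> = (\<Sum>l<n. q l * z' l)"
          by (subst sum.swap) (simp add: q_def sum_distrib_right mult.assoc)
        finally have "C * lin (Suc n) T z 0 + (\<Sum>k<n. m (Suc k) * lin n T' z' k) =
            C * z 0 + (\<Sum>i<n. (u i + v i * q i) * (C * z (Suc i)))"
          by (simp add: lin0 z'_def algebra_simps sum.distrib sum_distrib_left)
        moreover have "C * lin (Suc n) T z 0 = C * z 0 + (\<Sum>i<n. u i * (C * z (Suc i)))"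
          by (simp add: lin0 algebra_simps sum_distrib_left)
        ultimately show ?thesis using mono[of q, OF q] unfolding tail 0 by metis
      qed
    qed
    ultimately show "\<exists>T. triangular (Suc n) (1 + W + B * (C * W)) T \<and>
     (\<forall>i<Suc n. \<forall>m. (\<forall>k<Suc n. m k \<le> p) \<and> (\<forall>k\<le>i. m k = 0) \<longrightarrow>
        \<chi> (C * lin (Suc n) T z i + (\<Sum>k<Suc n. m k * lin (Suc n) T z k)) = \<chi> (C * lin (Suc n) T z i))"
      by blast
  qed
qed

text \<open>Back substitution: each form determines its diagonal variable once the later variables
  are known.\<close>

lemma triangular_lin_inj:
  assumes T: "triangular n B T" and eq: "\<And>i. i < n \<Longrightarrow> lin n T z i = lin n T z' i"
    and "k < n"
  shows "z k = z' k"
  using \<open>k < n\<close>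
proof (induction "n - k" arbitrary: k rule: less_induct)
  case less
  have split: "lin n T w k = T k k * w k + (\<Sum>l\<in>{k<..<n}. T k l * w l)" for w
  proof -
    have "lin n T w k = (\<Sum>l\<in>{k..<n}. T k l * w l)" unfolding lin_def
      by (rule sum.mono_neutral_right) (use T less.prems in \<open>auto simp: triangular_def\<close>)
    also have "{k..<n} = insert k {k<..<n}" using less.prems by auto
    finally show ?thesis by simp
  qed
  have "z l = z' l" if "l \<in> {k<..<n}" for l
    using less.hyps[of l] that by auto
  then have "T k k * z k = T k k * z' k"
    using eq[OF less.prems] unfolding split by simp
  moreover have "T k k > 0" using T less.prems by (simp add: triangular_def)
  ultimately show ?case by simp
qed

section \<open>Counting monochromatic solutions in an interval\<close>

text \<open>The finite counterpart of \<open>solutions\<close>: entries are confined to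
  \<open>A\<close>, so that \<open>card\<close> counts solutions.\<close>

definition sols :: "nat \<Rightarrow> (nat \<Rightarrow> int) \<Rightarrow> int set \<Rightarrow> (nat \<Rightarrow> int) set" where
  "sols s c A = {x \<in> {1..s} \<rightarrow>\<^sub>E A. (\<Sum>i=1..s. c i * x i) = 0}"

lemma finite_sols: "finite A \<Longrightarrow> finite (sols s c A)"
  unfolding sols_def by (rule finite_subset[OF _ finite_PiE[of "{1..s}" "\<lambda>_. A"]]) auto

lemma lin_le:
  assumes "triangular n B T" "\<And>k. k < n \<Longrightarrow> z k \<le> Z" "i < n"
  shows "lin n T z i \<le> n * B * Z"
proof -
  have "lin n T z i \<le> (\<Sum>k<n. B * Z)" unfolding lin_def
    using assms by (intro sum_mono mult_mono) (auto simp: triangular_def)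
  then show ?thesis by simp
qed

lemma lin_ge:
  assumes "triangular n B T" "i < n"
  shows "z i \<le> lin n T z i"
proof -
  have "1 * z i \<le> T i i * z i"
    using assms by (intro mult_le_mono1) (simp add: triangular_def Suc_le_eq)
  also have "\<dots> \<le> lin n T z i" unfolding lin_def
    using assms(2) by (intro member_le_sum) auto
  finally show ?thesis by simp
qed

lemma sgn_mult_le: "\<bar>x\<bar> \<le> q \<Longrightarrow> \<bar>sgn a * x\<bar> \<le> q" for a x q :: int
  by (cases "a = 0") (auto simp: abs_mult)

text \<open>The variable with index \<open>i\<^sub>0\<close> is the one that absorbs whatever the
  other variables leave over.\<close>

locale regular_equation =
  fixes s :: nat and c :: "nat \<Rightarrow> int" and I :: "nat set" and i\<^sub>0 :: nat
  assumes nz: "\<And>i. i \<in> {1..s} \<Longrightarrow> c i \<noteq> 0"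
    and I: "I \<subseteq> {1..s}" "i\<^sub>0 \<in> I" "sum c I = 0"
begin

definition p :: nat where "p = nat (\<Sum>i=1..s. \<bar>c i\<bar>)"
text \<open>Base points and perturbations are scaled by \<open>C\<close>, so that a correction at
  \<open>i\<^sub>0\<close> cancels their contribution without division.\<close>

definition C :: nat where "C = nat \<bar>c i\<^sub>0\<bar>"

lemma C_pos: "0 < C" using nz[of i\<^sub>0] I by (auto simp: C_def)

lemma int_p: "int p = (\<Sum>i=1..s. \<bar>c i\<bar>)" by (simp add: p_def sum_nonneg)

lemma int_C: "int C = sgn (c i\<^sub>0) * c i\<^sub>0" by (auto simp: C_def sgn_if)

text \<open>\<open>E\<close> and \<open>F\<close> are base points of two lines of the same colour, \<open>\<epsilon>\<close> gives the free perturbations.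
  The multiples of \<open>p\<close> may be added because the \<open>c i\<close> with \<open>i \<in> I\<close> sum to zero; they make all coefficients
  non-negative.\<close>
definition param :: "int \<Rightarrow> int \<Rightarrow> (nat \<Rightarrow> int) \<Rightarrow> nat \<Rightarrow> int" where
  "param E F \<epsilon> i = (if i \<in> I then int C * E + int p * F + int p * (\<Sum>k=1..s. \<epsilon> k) + int C * \<epsilon> i
      - (if i = i\<^sub>0 then sgn (c i\<^sub>0) * (sum c ({1..s} - I) * F + (\<Sum>k=1..s. c k * \<epsilon> k)) else 0)
    else int C * F + int C * \<epsilon> i)"

lemma param_cong:
  assumes "\<And>k. k \<in> {1..s} \<Longrightarrow> \<epsilon> k = \<epsilon>' k" "i \<in> {1..s}"
  shows "param E F \<epsilon> i = param E F \<epsilon>' i"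
proof -
  have "(\<Sum>k=1..s. \<epsilon> k) = (\<Sum>k=1..s. \<epsilon>' k)" "(\<Sum>k=1..s. c k * \<epsilon> k) = (\<Sum>k=1..s. c k * \<epsilon>' k)"
    using assms(1) by (auto intro: sum.cong)
  then show ?thesis using assms by (simp add: param_def)
qed

text \<open>The common part \<open>U\<close> on \<open>I\<close> is annihilated by
  \<open>sum c I = 0\<close>. Everything else adds up to \<open>C * V\<close>, and the correction at
  \<open>i\<^sub>0\<close> contributes \<open>- C * V\<close> because
  \<open>C = sgn (c i\<^sub>0) * c i\<^sub>0\<close>.\<close>

lemma param_solution: "(\<Sum>i=1..s. c i * param E F \<epsilon> i) = 0"
proof -
  define U where "U = int C * E + int p * F + int p * (\<Sum>k=1..s. \<epsilon> k)"
  define V where "V = sum c ({1..s} - I) * F + (\<Sum>k=1..s. c k * \<epsilon> k)"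
  have fin: "finite I" using I(1) finite_subset by blast
  have "(\<Sum>i\<in>I. c i * param E F \<epsilon> i) =
      (\<Sum>i\<in>I. c i * U + C * (c i * \<epsilon> i) - (if i = i\<^sub>0 then c i * (sgn (c i\<^sub>0) * V) else 0))"
    by (intro sum.cong) (auto simp: param_def U_def V_def algebra_simps)
  also have "\<dots> = sum c I * U + C * (\<Sum>i\<in>I. c i * \<epsilon> i) - c i\<^sub>0 * (sgn (c i\<^sub>0) * V)"
    using fin I(2) by (simp add: sum.distrib sum_subtractf sum_distrib_left sum_distrib_right)
  also have "c i\<^sub>0 * (sgn (c i\<^sub>0) * V) = C * V" by (simp add: int_C)
  finally have 1: "(\<Sum>i\<in>I. c i * param E F \<epsilon> i) = C * (\<Sum>i\<in>I. c i * \<epsilon> i) - C * V"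
    using I(3) by simp
  have "(\<Sum>i\<in>{1..s} - I. c i * param E F \<epsilon> i) = (\<Sum>i\<in>{1..s} - I. C * (c i * F) + C * (c i * \<epsilon> i))"
    by (intro sum.cong) (auto simp: param_def algebra_simps)
  then have 2: "(\<Sum>i\<in>{1..s} - I. c i * param E F \<epsilon> i) =
      C * (sum c ({1..s} - I) * F) + C * (\<Sum>i\<in>{1..s} - I. c i * \<epsilon> i)"
    by (simp add: sum.distrib sum_distrib_left sum_distrib_right)
  have 3: "(\<Sum>k=1..s. c k * \<epsilon> k) = (\<Sum>i\<in>{1..s} - I. c i * \<epsilon> i) + (\<Sum>i\<in>I. c i * \<epsilon> i)"
    using I(1) by (intro sum.subset_diff) auto
  have "(\<Sum>i=1..s. c i * param E F \<epsilon> i) =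
      (\<Sum>i\<in>{1..s} - I. c i * param E F \<epsilon> i) + (\<Sum>i\<in>I. c i * param E F \<epsilon> i)"
    using I(1) by (intro sum.subset_diff) auto
  then show ?thesis unfolding 1 2 V_def 3 by (simp add: algebra_simps)
qed

section \<open>Placing solutions on monochromatic lines\<close>

lemma abs_sum_le_p: "J \<subseteq> {1..s} \<Longrightarrow> \<bar>sum c J\<bar> \<le> int p"
  unfolding int_p by (rule order_trans[OF sum_abs sum_mono2]) auto

lemma abs_c_le_p: "i \<in> {1..s} \<Longrightarrow> \<bar>c i\<bar> \<le> int p"
  using abs_sum_le_p[of "{i}"] by simp

text \<open>The multiplicity of \<open>e k\<close> in \<open>param\<close> apart from the base term:
  \<open>e b\<close> plays the role of \<open>F\<close>, and the forms with indices
  \<open>r + 1\<close> to \<open>r + s\<close> are the perturbations. For these indices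
  \<open>p\<close> dominates what is subtracted, so \<open>nat\<close> truncates nothing.\<close>

definition coef :: "nat \<Rightarrow> nat \<Rightarrow> nat \<Rightarrow> nat \<Rightarrow> nat" where
  "coef r b i k = (if k = b then (if i \<in> I then nat (p - (if i = i\<^sub>0 then sgn (c i\<^sub>0) * sum c ({1..s} - I) else 0)) else 0)
    else if k > r then (if i \<in> I then nat (p - (if i = i\<^sub>0 then sgn (c i\<^sub>0) * c (k - r) else 0)) else 0) +
       (if i = k - r then C else 0)
    else 0)"

lemma coef_le:
  assumes "k \<le> r + s" "b \<le> r"
  shows "coef r b i k \<le> 3 * p"
proof -
  have nat_le: "nat (int p - x) \<le> 2 * p" if "\<bar>x\<bar> \<le> int p" for x
    using that by linarith
  have 1: "nat (int p - sgn (c i\<^sub>0) * sum c ({1..s} - I)) \<le> 2 * p"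
    by (intro nat_le sgn_mult_le abs_sum_le_p) auto
  have 2: "nat (int p - sgn (c i\<^sub>0) * c (k - r)) \<le> 2 * p" if "k > r"
    using that assms by (intro nat_le sgn_mult_le abs_c_le_p) auto
  have 3: "C \<le> p" using abs_c_le_p[of i\<^sub>0] I by (auto simp: C_def)
  define u where "u = nat (int p - sgn (c i\<^sub>0) * sum c ({1..s} - I))"
  define v where "v = nat (int p - sgn (c i\<^sub>0) * c (k - r))"
  have eq: "coef r b i k = (if k = b then (if i \<in> I then (if i = i\<^sub>0 then u else p) else 0)
      else if k > r then (if i \<in> I then (if i = i\<^sub>0 then v else p) else 0) + (if i = k - r then C else 0)
      else 0)"
    unfolding coef_def u_def v_def by (simp only: if_distrib diff_0_right nat_int cong: if_cong) simp
  show ?thesis unfolding eq using 1[folded u_def] 2[folded v_def] 3 by auto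
qed

text \<open>With \<open>E\<close> as the form \<open>e a\<close>, this puts coordinate
  \<open>i\<close> on the line of \<open>a\<close> or of \<open>b\<close>, in the shape to which
  \<open>monochromatic_lines\<close> applies.\<close>

lemma param_eq_coef:
  assumes b: "b \<le> r" and i: "i \<in> {1..s}"
  shows "param (int E) (int (e b)) (\<lambda>k. int (e (r + k))) i =
    int (C * (if i \<in> I then E else e b) + (\<Sum>k<r + s + 1. coef r b i k * e k))"
proof -
  have split: "(\<Sum>k<r + s + 1. coef r b i k * e k) =
      coef r b i b * e b + (\<Sum>k=1..s. coef r b i (r + k) * e (r + k))"
  proof -
    have "(\<Sum>k<r + s + 1. coef r b i k * e k) = (\<Sum>k\<in>insert b {r+1..r+s}. coef r b i k * e k)"
      by (rule sum.mono_neutral_right) (use b in \<open>auto simp: coef_def\<close>)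
    also have "\<dots> = coef r b i b * e b + (\<Sum>k\<in>{r+1..r+s}. coef r b i k * e k)"
      using b by (subst sum.insert) auto
    also have "(\<Sum>k\<in>{r+1..r+s}. coef r b i k * e k) = (\<Sum>k=1..s. coef r b i (r + k) * e (r + k))"
      by (rule sum.reindex_bij_witness[of _ "\<lambda>k. r + k" "\<lambda>k. k - r"]) auto
    finally show ?thesis .
  qed
  have 1: "sgn (c i\<^sub>0) * sum c ({1..s} - I) \<le> int p"
    by (rule abs_le_D1, intro sgn_mult_le abs_sum_le_p) auto
  have 2: "sgn (c i\<^sub>0) * c k \<le> int p" if "k \<in> {1..s}" for k
    by (rule abs_le_D1, intro sgn_mult_le abs_c_le_p that)
  have cb: "int (coef r b i b) = (if i \<in> I then p - (if i = i\<^sub>0 then sgn (c i\<^sub>0) * sum c ({1..s} - I) else 0) else 0)"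
    using 1 by (simp add: coef_def)
  have ck: "int (coef r b i (r + k)) = (if i \<in> I then p - (if i = i\<^sub>0 then sgn (c i\<^sub>0) * c k else 0) else 0)
      + (if i = k then C else 0)" if "k \<in> {1..s}" for k
    using 2[OF that] that b by (simp add: coef_def)
  define S S' where "S = (\<Sum>k=1..s. int (e (r + k)))"
    and "S' = (\<Sum>k=1..s. c k * int (e (r + k)))"
  have "int (\<Sum>k=1..s. coef r b i (r + k) * e (r + k)) =
     (\<Sum>k=1..s. (if i \<in> I then p * int (e (r + k)) else 0)
        - (if i \<in> I \<and> i = i\<^sub>0 then sgn (c i\<^sub>0) * (c k * int (e (r + k))) else 0)
        + (if k = i then C * int (e (r + k)) else 0))"
    unfolding of_nat_sum of_nat_mult
  proof (intro sum.cong refl)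
    fix k assume k: "k \<in> {1..s}"
    show "int (coef r b i (r + k)) * int (e (r + k)) = (if i \<in> I then p * int (e (r + k)) else 0)
        - (if i \<in> I \<and> i = i\<^sub>0 then sgn (c i\<^sub>0) * (c k * int (e (r + k))) else 0)
        + (if k = i then C * int (e (r + k)) else 0)"
      unfolding ck[OF k] by (auto simp: algebra_simps)
  qed
  also have "\<dots> = (if i \<in> I then p * S else 0) - (if i \<in> I \<and> i = i\<^sub>0 then sgn (c i\<^sub>0) * S' else 0)
      + C * int (e (r + i))"
  proof -
    have "(\<Sum>k=1..s. if i \<in> I then p * int (e (r + k)) else 0) = (if i \<in> I then p * S else 0)"
      by (simp add: S_def sum_distrib_left)
    moreover have "(\<Sum>k=1..s. if i \<in> I \<and> i = i\<^sub>0 then sgn (c i\<^sub>0) * (c k * int (e (r + k))) else 0) =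
        (if i \<in> I \<and> i = i\<^sub>0 then sgn (c i\<^sub>0) * S' else 0)"
    proof (cases "i \<in> I \<and> i = i\<^sub>0")
      case True
      then show ?thesis by (simp add: S'_def sum_distrib_left)
    next
      case False
      then show ?thesis by (simp only: if_not_P[OF False] if_False sum.neutral_const)
    qed
    moreover have "(\<Sum>k=1..s. if k = i then C * int (e (r + k)) else 0) = C * int (e (r + i))"
      using i by (simp add: sum.delta)
    ultimately show ?thesis unfolding sum.distrib sum_subtractf by simp
  qed
  finally have main: "int (\<Sum>k=1..s. coef r b i (r + k) * e (r + k)) = \<dots>" .
  show ?thesis
    unfolding split param_def of_nat_add main of_nat_mult cb S_def[symmetric] S'_def[symmetric]
    by (cases "i \<in> I"; cases "i = i\<^sub>0"; simp add: distrib_left left_diff_distrib right_diff_distrib)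
qed

text \<open>Among the first \<open>r + 1\<close> lines two, with indices \<open>a < b\<close>, share
  a colour. Since \<open>b\<close> comes after \<open>a\<close>, the form \<open>b\<close> may also
  appear as a perturbation on the line of \<open>a\<close>, so all coordinates receive that
  colour.\<close>

lemma monochromatic_param:
  "\<exists>B. \<forall>\<chi>::nat \<Rightarrow> nat. (\<forall>x. \<chi> x < r) \<longrightarrow> (\<forall>z. \<exists>T a b. triangular (r + s + 1) B T \<and> a < b \<and> b \<le> r \<and>
    (\<exists>col. \<forall>i\<in>{1..s}.
      \<chi> (nat (param (lin (r + s + 1) T z a) (lin (r + s + 1) T z b) (\<lambda>k. lin (r + s + 1) T z (r + k)) i)) = col))"
proof -
  define n where "n = r + s + 1"
  obtain B where B: "\<forall>\<chi>::nat \<Rightarrow> nat. (\<forall>x. \<chi> x < r) \<longrightarrow> (\<forall>z. \<exists>T. triangular n B T \<and>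
     (\<forall>i<n. \<forall>m. (\<forall>k<n. m k \<le> 3 * p) \<and> (\<forall>k\<le>i. m k = 0) \<longrightarrow>
        \<chi> (C * lin n T z i + (\<Sum>k<n. m k * lin n T z k)) = \<chi> (C * lin n T z i)))"
    using monochromatic_lines[OF C_pos] ..
  show ?thesis unfolding n_def[symmetric]
  proof (intro exI[of _ B] allI impI)
    fix \<chi> :: "nat \<Rightarrow> nat" and z assume \<chi>: "\<forall>x. \<chi> x < r"
    obtain T where T: "triangular n B T" and line: "\<And>i m. i < n \<Longrightarrow> (\<And>k. k < n \<Longrightarrow> m k \<le> 3 * p) \<Longrightarrow>
        (\<And>k. k \<le> i \<Longrightarrow> m k = 0) \<Longrightarrow>
        \<chi> (C * lin n T z i + (\<Sum>k<n. m k * lin n T z k)) = \<chi> (C * lin n T z i)"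
      using B[THEN spec, THEN mp, OF \<chi>, THEN spec, of z] by blast
    define col where "col i = \<chi> (C * lin n T z i)" for i
    have "\<not> inj_on col {..r}"
    proof
      assume "inj_on col {..r}"
      moreover have "col ` {..r} \<subseteq> {..<r}" using \<chi> by (auto simp: col_def)
      ultimately have "card {..r} \<le> card {..<r}" by (intro card_inj_on_le) auto
      then show False by simp
    qed
    then obtain a b where ab: "a < b" "b \<le> r" "col a = col b"
      unfolding inj_on_def by (metis atMost_iff linorder_neqE_nat)
    have "\<chi> (nat (param (lin n T z a) (lin n T z b) (\<lambda>k. lin n T z (r + k)) i)) = col b"
      if i: "i \<in> {1..s}" for i
    proof -
      define j where "j = (if i \<in> I then a else b)"
      have "param (lin n T z a) (lin n T z b) (\<lambda>k. lin n T z (r + k)) i =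
          int (C * lin n T z j + (\<Sum>k<n. coef r b i k * lin n T z k))"
        unfolding n_def j_def if_distrib[of "lin _ _ _"] by (intro param_eq_coef ab i)
      then have "\<chi> (nat (param (lin n T z a) (lin n T z b) (\<lambda>k. lin n T z (r + k)) i)) =
          \<chi> (C * lin n T z j + (\<Sum>k<n. coef r b i k * lin n T z k))"
        by (simp only: nat_int)
      also have "\<dots> = col j" unfolding col_def
      proof (rule line)
        show "j < n" using ab by (simp add: j_def n_def)
        show "coef r b i k \<le> 3 * p" if "k < n" for k
          using that ab by (intro coef_le) (auto simp: n_def)
        \<comment> \<open>For \<open>i\<close> in \<open>I\<close> the line starts at
          \<open>a < b\<close>, so \<open>e b\<close> may occur; otherwise it starts at
          \<open>b\<close>, where the coefficient vanishes.\<close>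
        show "coef r b i k = 0" if "k \<le> j" for k
          using that ab by (auto simp: coef_def j_def split: if_splits)
      qed
      also have "\<dots> = col b" using ab by (simp add: j_def)
      finally show ?thesis .
    qed
    then show "\<exists>T a b. triangular n B T \<and> a < b \<and> b \<le> r \<and> (\<exists>col. \<forall>i\<in>{1..s}.
      \<chi> (nat (param (lin n T z a) (lin n T z b) (\<lambda>k. lin n T z (r + k)) i)) = col)"
      using T ab by blast
  qed
qed

text \<open>With the sum of the perturbations fixed, every coordinate other than
  \<open>i\<^sub>0\<close> reveals its own perturbation. The coordinate \<open>i\<^sub>0\<close>
  carries the correction, so its perturbation is recovered from the sum.\<close>

lemma param_inj:
  assumes "\<And>i. i \<in> {1..s} \<Longrightarrow> param E F \<epsilon> i = param E F \<epsilon>' i"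
    and sum: "(\<Sum>k=1..s. \<epsilon> k) = (\<Sum>k=1..s. \<epsilon>' k)" and k: "k \<in> {1..s}"
  shows "\<epsilon> k = \<epsilon>' k"
proof -
  have eq: "\<epsilon> i = \<epsilon>' i" if "i \<in> {1..s}" "i \<noteq> i\<^sub>0" for i
    using assms(1)[OF that(1)] that sum C_pos by (auto simp: param_def split: if_splits)
  have i0: "i\<^sub>0 \<in> {1..s}" using I by auto
  have "(\<Sum>k=1..s. \<epsilon> k) = \<epsilon> i\<^sub>0 + (\<Sum>k\<in>{1..s} - {i\<^sub>0}. \<epsilon> k)"
    "(\<Sum>k=1..s. \<epsilon>' k) = \<epsilon>' i\<^sub>0 + (\<Sum>k\<in>{1..s} - {i\<^sub>0}. \<epsilon>' k)"
    using i0 by (simp_all add: sum.remove)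
  moreover have "(\<Sum>k\<in>{1..s} - {i\<^sub>0}. \<epsilon> k) = (\<Sum>k\<in>{1..s} - {i\<^sub>0}. \<epsilon>' k)"
    by (intro sum.cong) (auto simp: eq)
  ultimately have "\<epsilon> i\<^sub>0 = \<epsilon>' i\<^sub>0" using sum by simp
  then show ?thesis using eq k by blast
qed


lemma param_bounds:
  assumes T: "triangular (r + s + 1) B T" and z: "\<And>k. k < r + s + 1 \<Longrightarrow> z k \<in> {1..Z}"
    and ab: "a \<le> r" "b \<le> r" and i: "i \<in> {1..s}"
  defines "e \<equiv> lin (r + s + 1) T z"
  shows "param (e a) (e b) (\<lambda>k. e (r + k)) i \<in>
    {1..int ((C + (r + s + 1) * (3 * p)) * ((r + s + 1) * B) * Z)}"
proof -
  define n where "n = r + s + 1"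
  have upper: "e k \<le> n * B * Z" if "k < n" for k
    unfolding e_def n_def using lin_le[OF T] z that by (auto simp: n_def)
  have lower: "1 \<le> e k" if "k < n" for k
    unfolding e_def using lin_ge[OF T, of k z] z[of k] that by (auto simp: n_def)
  define j where "j = (if i \<in> I then a else b)"
  have j: "j < n" using ab by (simp add: j_def n_def)
  have "param (e a) (e b) (\<lambda>k. e (r + k)) i = int (C * e j + (\<Sum>k<n. coef r b i k * e k))"
    unfolding n_def j_def if_distrib[of e] by (intro param_eq_coef ab i)
  moreover have "1 \<le> C * e j + (\<Sum>k<n. coef r b i k * e k)"
    using C_pos lower[OF j] by (simp add: Suc_le_eq)
  moreover have "C * e j + (\<Sum>k<n. coef r b i k * e k) \<le> C * (n * B * Z) + (\<Sum>k<n. 3 * p * (n * B * Z))"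
    by (intro add_mono mult_left_mono sum_mono mult_mono coef_le upper j) (use ab in \<open>auto simp: n_def\<close>)
  moreover have "\<dots> = (C + n * (3 * p)) * (n * B) * Z" by (simp add: algebra_simps)
  ultimately show ?thesis unfolding n_def[symmetric] by (simp only: atLeastAtMost_iff) linarith
qed

text \<open>A triangular system with positive diagonal is injective, so \<open>z\<close> is determined by the solution
  together with the first \<open>r + 1\<close> linear forms and the sum of the remaining ones.\<close>
lemma param_fibre_card:
  assumes T: "triangular (r + s + 1) B T" and X: "finite X" and ab: "a \<le> r" "b \<le> r"
    and G: "G \<subseteq> {..<r + s + 1} \<rightarrow>\<^sub>E {1..Z}"
    and param: "\<And>z. z \<in> G \<Longrightarrow> restrict (param (lin (r + s + 1) T z a) (lin (r + s + 1) T z b)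
        (\<lambda>k. lin (r + s + 1) T z (r + k))) {1..s} \<in> X"
  shows "card G \<le> (Suc ((s + 1) * ((r + s + 1) * B * Z))) ^ (r + 2) * card X"
proof -
  define n where "n = r + s + 1"
  define e where "e = lin n T"
  define K where "K = (s + 1) * (n * B * Z)"
  \<comment> \<open>The entry with index \<open>r + 1\<close> is the sum. Fixing these
    \<open>r + 2\<close> values leaves \<open>s - 1\<close> of the \<open>r + s + 1\<close> degrees
    of freedom, as many as one equation in \<open>s\<close> variables has.\<close>
  define d where "d z = restrict (\<lambda>i. if i \<le> r then e z i else (\<Sum>k=1..s. e z (r + k))) {..<r + 2}" for z
  define x where "x z = restrict (param (e z a) (e z b) (\<lambda>k. e z (r + k))) {1..s}" for z
  have upper: "e z k \<le> n * B * Z" if "k < n" "z \<in> G" for z k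
    unfolding e_def using that G T lin_le[OF T] by (auto simp: n_def PiE_iff subset_iff)
  have "(\<lambda>z. (d z, x z)) ` G \<subseteq> ({..<r + 2} \<rightarrow>\<^sub>E {..K}) \<times> X"
  proof (clarify, intro conjI SigmaI)
    fix z assume z: "z \<in> G"
    show "x z \<in> X" using param[OF z] by (simp add: x_def e_def n_def)
    have "(\<Sum>k=1..s. e z (r + k)) \<le> (\<Sum>k=1..s. n * B * Z)"
      by (intro sum_mono upper z) (auto simp: n_def)
    then have 1: "(\<Sum>k=1..s. e z (r + k)) \<le> K" by (simp add: K_def)
    have 2: "e z k \<le> K" if "k \<le> r" for k
      using upper[OF _ z, of k] that by (simp add: K_def n_def)
    show "d z \<in> {..<r + 2} \<rightarrow>\<^sub>E {..K}" using 1 2 by (auto simp: d_def)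
  qed
  moreover have "inj_on (\<lambda>z. (d z, x z)) G"
  proof (rule inj_onI)
    fix z z' assume z: "z \<in> G" "z' \<in> G" and "(d z, x z) = (d z', x z')"
    then have d: "d z = d z'" and x: "x z = x z'" by auto
    have low: "e z i = e z' i" if "i \<le> r" for i
      using fun_cong[OF d, of i] that by (simp add: d_def)
    have "(\<Sum>k=1..s. e z (r + k)) = (\<Sum>k=1..s. e z' (r + k))"
      using fun_cong[OF d, of "r + 1"] by (simp add: d_def)
    then have sum: "(\<Sum>k=1..s. int (e z (r + k))) = (\<Sum>k=1..s. int (e z' (r + k)))"
      by (metis of_nat_sum)
    have "int (e z (r + k)) = int (e z' (r + k))" if "k \<in> {1..s}" for k
    proof (rule param_inj[OF _ sum that])
      fix i assume i: "i \<in> {1..s}"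
      show "param (e z a) (e z b) (\<lambda>k. e z (r + k)) i = param (e z a) (e z b) (\<lambda>k. e z' (r + k)) i"
        using fun_cong[OF x, of i] i low[OF ab(1)] low[OF ab(2)] by (simp add: x_def)
    qed
    then have high: "e z (r + k) = e z' (r + k)" if "k \<in> {1..s}" for k
      using that by simp
    have "e z i = e z' i" if "i < n" for i
    proof (cases "i \<le> r")
      case False
      then have "i - r \<in> {1..s}" using that unfolding atLeastAtMost_iff n_def by arith
      then show ?thesis using high[of "i - r"] False by simp
    qed (use low in auto)
    then have eq: "z k = z' k" if "k < n" for k
      using triangular_lin_inj[OF T[folded n_def], of z z'] that unfolding e_def by blast
    have "z \<in> {..<n} \<rightarrow>\<^sub>E {1..Z}" "z' \<in> {..<n} \<rightarrow>\<^sub>E {1..Z}"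
      using z G by (auto simp: n_def)
    then show "z = z'" by (rule PiE_ext) (use eq in auto)
  qed
  ultimately have "card G \<le> card (({..<r + 2} \<rightarrow>\<^sub>E {..K}) \<times> X)"
    using X by (intro card_inj_on_le[of "\<lambda>z. (d z, x z)"]) (auto intro: finite_PiE)
  also have "\<dots> = Suc K ^ (r + 2) * card X"
    by (simp add: card_cartesian_product card_PiE)
  finally show ?thesis by (simp add: K_def n_def)
qed

text \<open>Each parameter vector in a box of side \<open>N div D\<close> yields a monochromatic
  solution through one of boundedly many triples \<open>(T, a, b)\<close>, and for each triple a
  solution arises from at most \<open>(K * N) ^ (r + 2)\<close> vectors. The exponent
  \<open>n - (r + 2) = s - 1\<close> remains.\<close>

theorem many_monochromatic_solutions:
  fixes r :: nat
  assumes s: "1 \<le> s" and r: "0 < r"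
  shows "\<exists>\<kappa>>0. \<exists>N\<^sub>0. \<forall>N\<ge>N\<^sub>0. \<forall>A. {1..int N} \<subseteq> (\<Union>j<r. A j) \<longrightarrow>
    \<kappa> * real N ^ (s - 1) \<le> (\<Sum>j<r. real (card (sols s c (A j \<inter> {1..int N}))))"
proof -
  define n where "n = r + s + 1"
  obtain B where B: "\<forall>\<chi>::nat \<Rightarrow> nat. (\<forall>x. \<chi> x < r) \<longrightarrow> (\<forall>z. \<exists>T a b. triangular n B T \<and> a < b \<and> b \<le> r \<and>
    (\<exists>col. \<forall>i\<in>{1..s}. \<chi> (nat (param (lin n T z a) (lin n T z b) (\<lambda>k. lin n T z (r + k)) i)) = col))"
    using monochromatic_param unfolding n_def ..
  \<comment> \<open>\<open>D\<close> exceeds the factor in \<open>param_bounds\<close>, so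
    parameters up to \<open>N div D\<close> keep the solution inside the interval.\<close>
  define D where "D = (C + n * (3 * p)) * (n * B) + 1"
  define Idx where "Idx = ({..<n} \<rightarrow>\<^sub>E {..<n} \<rightarrow>\<^sub>E {..B}) \<times> {..r} \<times> {..r}"
  define K where "K = (s + 1) * (n * B) + 1"
  define \<kappa> where "\<kappa> = 1 / ((2 * real D) ^ n * (1 + real (card Idx)) * real K ^ (r + 2))"
  have fin_Idx: "finite Idx" unfolding Idx_def by (intro finite_cartesian_product finite_PiE) auto
  have pos: "D > 0" "K > 0" by (simp_all add: D_def K_def)
  show ?thesis
  proof (intro exI[of _ \<kappa>] exI[of _ D] conjI allI impI)
    show "0 < \<kappa>" using pos by (simp add: \<kappa>_def)
    fix N and A :: "nat \<Rightarrow> int set" assume N: "D \<le> N" and A: "{1..int N} \<subseteq> (\<Union>j<r. A j)"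
    define X where "X = (\<Union>j<r. sols s c (A j \<inter> {1..int N}))"
    have fin_X: "finite X" unfolding X_def by (auto intro!: finite_sols)
    \<comment> \<open>The classes may overlap, so one is selected. Outside the interval 0 is a dummy
      colour; the solutions constructed below stay inside.\<close>
    define \<chi> where "\<chi> x = (if x \<in> {1..N} then SOME j. j < r \<and> int x \<in> A j else 0)" for x
    have \<chi>: "\<chi> x < r \<and> int x \<in> A (\<chi> x)" if "x \<in> {1..N}" for x
    proof -
      have "int x \<in> {1..int N}" using that by auto
      then have "int x \<in> (\<Union>j<r. A j)" using A by blast
      then have "\<exists>j. j < r \<and> int x \<in> A j" by auto
      from someI_ex[OF this] show ?thesis using that by (simp add: \<chi>_def)
    qed
    have \<chi>_less: "\<forall>x. \<chi> x < r"
    proof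
      fix x show "\<chi> x < r"
        using \<chi>[of x] r by (cases "x \<in> {1..N}") (simp_all add: \<chi>_def)
    qed
    define Z where "Z = N div D"
    have DZ: "D * Z \<le> N" by (simp add: Z_def)
    have Z1: "Z \<ge> 1" using N pos by (simp add: Z_def div_greater_zero_iff Suc_le_eq)
    define x where "x T a b z = restrict (param (lin n T z a) (lin n T z b) (\<lambda>k. lin n T z (r + k))) {1..s}"
      for T a b z
    define G where "G = (\<lambda>(T, a, b). {z \<in> {..<n} \<rightarrow>\<^sub>E {1..Z}. triangular n B T \<and> x T a b z \<in> X})"
    have cover: "({..<n} \<rightarrow>\<^sub>E {1..Z}) \<subseteq> (\<Union>t\<in>Idx. G t)"
    proof
      fix z assume z: "z \<in> {..<n} \<rightarrow>\<^sub>E {1..Z}"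
      obtain T a b col where T: "triangular n B T" and ab: "a < b" "b \<le> r" and
        col: "\<And>i. i \<in> {1..s} \<Longrightarrow> \<chi> (nat (param (lin n T z a) (lin n T z b) (\<lambda>k. lin n T z (r + k)) i)) = col"
        using B[THEN spec, THEN mp, OF \<chi>_less, THEN spec, of z] by blast
      \<comment> \<open>Cutting off the entries outside the square makes the matrix a member of the
        finite set \<open>Idx\<close> and leaves the forms unchanged.\<close>
      define T' where "T' = (\<lambda>i\<in>{..<n}. \<lambda>k\<in>{..<n}. T i k)"
      have T': "triangular n B T'" using T by (auto simp: triangular_def T'_def)
      have lin: "lin n T' z i = lin n T z i" if "i < n" for i
        using that by (simp add: lin_def T'_def)
      have less: "a < n" "b < n" using ab by (auto simp: n_def)
      have "x T' a b z \<in> sols s c (A col \<inter> {1..int N}) \<and> col < r"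
      proof (intro conjI)
        have mem: "x T' a b z i \<in> A col \<inter> {1..int N} \<and> col < r" if i: "i \<in> {1..s}" for i
        proof -
          define y where "y = param (lin n T z a) (lin n T z b) (\<lambda>k. lin n T z (r + k)) i"
          have "r + i < n" using i by (simp add: n_def)
          have x: "x T' a b z i = y"
          proof -
            have lin': "int (lin n T' z (r + k)) = int (lin n T z (r + k))" if "k \<in> {1..s}" for k
              using lin[of "r + k"] that by (simp add: n_def)
            have "param E F (\<lambda>k. int (lin n T' z (r + k))) i = param E F (\<lambda>k. int (lin n T z (r + k))) i" for E F
              by (rule param_cong[OF lin' i])
            then show ?thesis using i less by (simp add: x_def y_def lin)
          qed
          have "y \<in> {1..int ((C + n * (3 * p)) * (n * B) * Z)}"
            unfolding y_def n_def
          proof (rule param_bounds[OF T[unfolded n_def] _ _ ab(2) i])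
            show "z k \<in> {1..Z}" if "k < r + s + 1" for k
              using PiE_mem[OF z, of k] that by (simp add: n_def)
          qed (use ab in simp)
          moreover have "(C + n * (3 * p)) * (n * B) * Z \<le> N"
            using DZ by (simp add: D_def)
          ultimately have y: "y \<in> {1..int N}"
            by (meson atLeastAtMost_iff of_nat_mono order_trans)
          then have "nat y \<in> {1..N}" by auto
          from \<chi>[OF this] have "int (nat y) \<in> A col" "col < r" using col[OF i] by (auto simp: y_def)
          then show ?thesis using x y by auto
        qed
        show "col < r" using mem[of 1] s by auto
        have "x T' a b z \<in> {1..s} \<rightarrow>\<^sub>E (A col \<inter> {1..int N})"
        proof (rule PiE_I)
          show "x T' a b z i \<in> A col \<inter> {1..int N}" if "i \<in> {1..s}" for i using mem[OF that] by blast
        qed (auto simp: x_def)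
        moreover have "(\<Sum>i=1..s. c i * x T' a b z i) = 0"
          using param_solution by (simp add: x_def)
        ultimately show "x T' a b z \<in> sols s c (A col \<inter> {1..int N})" by (simp add: sols_def)
      qed
      then have "x T' a b z \<in> X" by (auto simp: X_def)
      then have "z \<in> G (T', a, b)" using z T' by (simp add: G_def)
      moreover have "(T', a, b) \<in> Idx" using T ab by (auto simp: Idx_def T'_def triangular_def)
      ultimately show "z \<in> (\<Union>t\<in>Idx. G t)" by blast
    qed
    have card_G: "card (G t) \<le> (K * N) ^ (r + 2) * card X" if t: "t \<in> Idx" for t
    proof -
      obtain T a b where [simp]: "t = (T, a, b)" by (cases t)
      show ?thesis
      proof (cases "triangular n B T")
        case True
        have "card (G t) \<le> Suc ((s + 1) * (n * B * Z)) ^ (r + 2) * card X"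
          unfolding n_def
        proof (rule param_fibre_card[OF True[unfolded n_def] fin_X])
          show "a \<le> r" "b \<le> r" using t by (simp_all add: Idx_def)
          show "G t \<subseteq> {..<r + s + 1} \<rightarrow>\<^sub>E {1..Z}" by (auto simp: G_def n_def)
        qed (simp add: G_def x_def n_def)
        also have "\<dots> \<le> (K * N) ^ (r + 2) * card X"
        proof (intro mult_right_mono power_mono)
          have "Z \<le> N" by (simp add: Z_def)
          then have "(s + 1) * (n * B) * Z \<le> (s + 1) * (n * B) * N" by (rule mult_le_mono2)
          moreover have "1 \<le> N" using N pos by simp
          ultimately show "Suc ((s + 1) * (n * B * Z)) \<le> K * N"
            unfolding K_def by (simp add: algebra_simps)
        qed auto
        finally show ?thesis .
      qed (simp add: G_def)
    qed
    have "Z ^ n = card ({..<n} \<rightarrow>\<^sub>E {1..Z})" by (simp add: card_PiE)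
    also have "\<dots> \<le> card (\<Union>t\<in>Idx. G t)"
      using fin_Idx by (intro card_mono cover finite_UN_I) (auto simp: G_def intro!: finite_PiE)
    also have "\<dots> \<le> (\<Sum>t\<in>Idx. card (G t))" by (rule card_UN_le[OF fin_Idx])
    also have "\<dots> \<le> card Idx * ((K * N) ^ (r + 2) * card X)"
      using sum_bounded_above[of Idx "\<lambda>t. card (G t)", OF card_G] by simp
    finally have Zn: "real Z ^ n \<le> real (card Idx) * ((real K * real N) ^ (r + 2) * real (card X))"
      by (metis of_nat_le_iff of_nat_mult of_nat_power)
    have "real N \<le> 2 * real D * real Z"
    proof -
      have "N = D * Z + N mod D" by (simp add: Z_def)
      moreover have "N mod D < D" using pos by simp
      moreover have "D * 1 \<le> D * Z" using Z1 by (intro mult_le_mono2)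
      ultimately have "N \<le> 2 * (D * Z)" by linarith
      then have "N \<le> 2 * D * Z" by simp
      then show ?thesis by (metis of_nat_le_iff of_nat_mult of_nat_numeral)
    qed
    then have "real N ^ n \<le> (2 * real D) ^ n * real Z ^ n"
      by (metis power_mono power_mult_distrib of_nat_0_le_iff)
    also have "\<dots> \<le> (2 * real D) ^ n * (real (card Idx) * ((real K * real N) ^ (r + 2) * real (card X)))"
      by (intro mult_left_mono Zn) simp
    also have "\<dots> \<le> (2 * real D) ^ n * ((1 + real (card Idx)) * ((real K * real N) ^ (r + 2) * real (card X)))"
      by (intro mult_left_mono mult_right_mono) auto
    also have "\<dots> = real N ^ (r + 2) * (real (card X) / \<kappa>)"
      by (simp add: \<kappa>_def power_mult_distrib)
    finally have "real N ^ n \<le> real N ^ (r + 2) * (real (card X) / \<kappa>)" .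
    moreover have "n = (r + 2) + (s - 1)" using s by (simp add: n_def)
    ultimately have "real N ^ (r + 2) * real N ^ (s - 1) \<le> real N ^ (r + 2) * (real (card X) / \<kappa>)"
      by (simp only: power_add)
    then have "real N ^ (s - 1) \<le> real (card X) / \<kappa>"
      using N pos by (simp only: mult_le_cancel_left_pos zero_less_power of_nat_0_less_iff)
    then have "\<kappa> * real N ^ (s - 1) \<le> real (card X)"
      using \<open>0 < \<kappa>\<close> by (simp add: field_simps)
    also have "\<dots> \<le> (\<Sum>j<r. real (card (sols s c (A j \<inter> {1..int N}))))"
      unfolding X_def using card_UN_le[of "{..<r}" "\<lambda>j. sols s c (A j \<inter> {1..int N})"]
      by (metis finite_lessThan of_nat_le_iff of_nat_sum)
    finally show "\<kappa> * real N ^ (s - 1) \<le> (\<Sum>j<r. real (card (sols s c (A j \<inter> {1..int N}))))" .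
  qed
qed

end

section \<open>Fourier sums modulo M and Bohr sets\<close>

definition ee :: "nat \<Rightarrow> int \<Rightarrow> complex" where
  "ee M x = cis (2 * pi * real_of_int x / real M)"

lemma ee_0 [simp]: "ee M 0 = 1" by (simp add: ee_def)

lemma norm_ee [simp]: "norm (ee M x) = 1" by (simp add: ee_def)

lemma ee_add: "ee M (x + y) = ee M x * ee M y"
  by (simp add: ee_def cis_mult add_divide_distrib distrib_left)

lemma ee_sum: "ee M (sum f J) = (\<Prod>i\<in>J. ee M (f i))"
  by (induction J rule: infinite_finite_induct) (auto simp: ee_add)

lemma ee_minus: "ee M (- x) = cnj (ee M x)" by (simp add: ee_def cis_cnj)

lemma ee_eq_1_iff: "M > 0 \<Longrightarrow> ee M x = 1 \<longleftrightarrow> int M dvd x"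
proof -
  assume M: "M > 0"
  have "ee M x = 1 \<longleftrightarrow> (\<exists>n. real_of_int x = real_of_int n * real M)"
    using M by (auto simp: ee_def cis_eq_1_iff field_simps)
  also have "\<dots> \<longleftrightarrow> (\<exists>n. x = n * int M)"
    by (metis of_int_eq_iff of_int_mult of_int_of_nat_eq)
  finally show ?thesis by (auto simp: dvd_def mult.commute)
qed

lemma ee_mult_nat: "ee M (int k * x) = ee M x ^ k"
  by (simp add: ee_def DeMoivre algebra_simps)

lemma ee_mod: "M > 0 \<Longrightarrow> ee M (k mod int M * x) = ee M (k * x)"
proof -
  assume M: "M > 0"
  have "ee M (k * x) = ee M (k div int M * int M * x + k mod int M * x)"
    by (simp flip: distrib_right)
  also have "\<dots> = ee M (k mod int M * x)"
    using ee_eq_1_iff[OF M, of "k div int M * int M * x"] by (simp add: ee_add)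
  finally show ?thesis by simp
qed

lemma ee_orthogonality:
  assumes "M > 0"
  shows "(\<Sum>k<M. ee M (int k * x)) = (if int M dvd x then of_nat M else 0)"
proof (cases "int M dvd x")
  case True
  then have "ee M x = 1" using ee_eq_1_iff[OF assms] by simp
  then show ?thesis using True by (simp add: ee_mult_nat)
next
  case False
  then have 1: "ee M x \<noteq> 1" using ee_eq_1_iff[OF assms] by simp
  have "ee M x ^ M = 1"
    using ee_mult_nat[of M M x] ee_eq_1_iff[OF assms, of "int M * x"] by simp
  then show ?thesis using False geometric_sum[OF 1, of M] by (simp add: ee_mult_nat)
qed

definition fsum :: "nat \<Rightarrow> int set \<Rightarrow> (int \<Rightarrow> real) \<Rightarrow> int \<Rightarrow> complex" where
  "fsum M X g k = (\<Sum>x\<in>X. of_real (g x) * ee M (k * x))"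

lemma fsum_mod: "M > 0 \<Longrightarrow> fsum M X g (k mod int M) = fsum M X g k"
  by (simp add: fsum_def ee_mod)

text \<open>Orthogonality counts solutions of the congruence modulo \<open>M\<close>. Since
  \<open>M\<close> exceeds every possible absolute value of the linear form, these are the solutions
  of the equation.\<close>

lemma fsum_count:
  assumes X: "finite X" "\<And>x. x \<in> X \<Longrightarrow> \<bar>x\<bar> \<le> L" and M: "L * (\<Sum>i=1..s. \<bar>c i\<bar>) < int M" and "M > 0"
  shows "(\<Sum>k<M. \<Prod>i=1..s. fsum M X g (c i * int k)) =
    of_nat M * of_real (\<Sum>x\<in>sols s c X. \<Prod>i=1..s. g (x i))"
proof -
  have fin: "finite ({1..s} \<rightarrow>\<^sub>E X)" using X by (intro finite_PiE) auto
  have dvd: "int M dvd (\<Sum>i=1..s. c i * x i) \<longleftrightarrow> (\<Sum>i=1..s. c i * x i) = 0" if "x \<in> {1..s} \<rightarrow>\<^sub>E X" for x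
  proof
    assume "int M dvd (\<Sum>i=1..s. c i * x i)"
    moreover have "\<bar>\<Sum>i=1..s. c i * x i\<bar> < int M"
    proof -
      have "\<bar>\<Sum>i=1..s. c i * x i\<bar> \<le> (\<Sum>i=1..s. \<bar>c i * x i\<bar>)" by (rule sum_abs)
      also have "\<dots> \<le> (\<Sum>i=1..s. L * \<bar>c i\<bar>)"
      proof (intro sum_mono)
        fix i assume "i \<in> {1..s}"
        then have "\<bar>x i\<bar> \<le> L" using X(2) PiE_mem[OF that] by blast
        then have "\<bar>c i\<bar> * \<bar>x i\<bar> \<le> \<bar>c i\<bar> * L" by (rule mult_left_mono) simp
        then show "\<bar>c i * x i\<bar> \<le> L * \<bar>c i\<bar>" by (simp add: abs_mult mult.commute)
      qed
      finally show ?thesis using M by (simp add: sum_distrib_left)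
    qed
    ultimately show "(\<Sum>i=1..s. c i * x i) = 0" by (metis abs_of_nat dvd_imp_le_int not_le)
  qed simp
  have "(\<Prod>i=1..s. fsum M X g (c i * int k)) =
      (\<Sum>x\<in>{1..s} \<rightarrow>\<^sub>E X. of_real (\<Prod>i=1..s. g (x i)) * ee M (int k * (\<Sum>i=1..s. c i * x i)))" for k
  proof -
    have "(\<Prod>i=1..s. fsum M X g (c i * int k)) =
        (\<Sum>x\<in>{1..s} \<rightarrow>\<^sub>E X. \<Prod>i=1..s. of_real (g (x i)) * ee M (c i * int k * x i))"
      unfolding fsum_def using X by (intro prod_sum_PiE) auto
    also have "\<dots> = (\<Sum>x\<in>{1..s} \<rightarrow>\<^sub>E X. of_real (\<Prod>i=1..s. g (x i)) * ee M (int k * (\<Sum>i=1..s. c i * x i)))"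
      by (intro sum.cong) (simp_all add: prod.distrib sum_distrib_left ee_sum mult_ac)
    finally show ?thesis .
  qed
  then have "(\<Sum>k<M. \<Prod>i=1..s. fsum M X g (c i * int k)) =
      (\<Sum>x\<in>{1..s} \<rightarrow>\<^sub>E X. of_real (\<Prod>i=1..s. g (x i)) * (\<Sum>k<M. ee M (int k * (\<Sum>i=1..s. c i * x i))))"
    by (simp only: sum_distrib_left) (rule sum.swap)
  also have "\<dots> = (\<Sum>x\<in>{1..s} \<rightarrow>\<^sub>E X. if (\<Sum>i=1..s. c i * x i) = 0
      then of_nat M * of_real (\<Prod>i=1..s. g (x i)) else 0)"
  proof (intro sum.cong refl)
    fix x assume x: "x \<in> {1..s} \<rightarrow>\<^sub>E X"
    show "of_real (\<Prod>i=1..s. g (x i)) * (\<Sum>k<M. ee M (int k * (\<Sum>i=1..s. c i * x i))) =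
        (if (\<Sum>i=1..s. c i * x i) = 0 then of_nat M * of_real (\<Prod>i=1..s. g (x i)) else 0)"
      unfolding ee_orthogonality[OF \<open>M > 0\<close>] dvd[OF x] by simp
  qed
  also have "\<dots> = (\<Sum>x\<in>sols s c X. of_nat M * of_real (\<Prod>i=1..s. g (x i)))"
    unfolding sols_def by (rule sum.inter_filter[OF fin, symmetric])
  finally show ?thesis by (simp add: sum_distrib_left)
qed

section \<open>Additive energy and fourth moments of Sidon sets\<close>

lemma sidonD:
  assumes "sidon S" "a \<in> S" "b \<in> S" "c \<in> S" "d \<in> S" "a - b = c - d" "a \<noteq> b"
  shows "a = c \<and> b = d"
proof -
  have "a - b \<noteq> 0" using assms by simp
  then have "\<exists>\<^sub>\<le>\<^sub>1(s\<^sub>1, s\<^sub>2). s\<^sub>1 \<in> S \<and> s\<^sub>2 \<in> S \<and> a - b = s\<^sub>1 - s\<^sub>2"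
    using assms(1) unfolding sidon_def by blast
  from Uniq_D[OF this, of "(a, b)" "(c, d)"] show ?thesis using assms by auto
qed

text \<open>After division by \<open>d\<close> the equation is \<open>x 1 + x 2 = x 3 + x 4\<close>,
  which has only trivial solutions in a Sidon set: \<open>f\<close> lists those with
  \<open>x 1 = x 3\<close>, \<open>g\<close> those with \<open>x 1 = x 4\<close>.\<close>

lemma card_sidon_sols:
  assumes S: "sidon S" and A: "A \<subseteq> S" "finite A" and d: "d \<noteq> 0"
  shows "card (sols 4 (\<lambda>i. if i \<le> 2 then d else - d) A) \<le> 2 * card A ^ 2"
proof -
  define f :: "int \<times> int \<Rightarrow> nat \<Rightarrow> int" where
    "f = (\<lambda>(a, b). \<lambda>i\<in>{1..4}. if i = 1 \<or> i = 3 then a else b)"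
  define g :: "int \<times> int \<Rightarrow> nat \<Rightarrow> int" where
    "g = (\<lambda>(a, b). \<lambda>i\<in>{1..4}. if i = 1 \<or> i = 4 then a else b)"
  have set4: "{1..4::nat} = {1, 2, 3, 4}" by auto
  have "sols 4 (\<lambda>i. if i \<le> 2 then d else - d) A \<subseteq> f ` (A \<times> A) \<union> g ` (A \<times> A)"
  proof
    fix x assume "x \<in> sols 4 (\<lambda>i. if i \<le> 2 then d else - d) A"
    then have x: "x \<in> {1..4} \<rightarrow>\<^sub>E A" and "(\<Sum>i=1..4. (if i \<le> 2 then d else - d) * x i) = 0"
      unfolding sols_def by blast+
    then have "d * (x 1 + x 2 - x 3 - x 4) = 0"
      unfolding set4 by (simp add: algebra_simps)
    then have eq: "x 1 - x 3 = x 4 - x 2" using d by simp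
    have mem: "x 1 \<in> A" "x 2 \<in> A" "x 3 \<in> A" "x 4 \<in> A" by (rule PiE_mem[OF x]; simp)+
    have undef: "x i = undefined" if "i \<notin> {1..4}" for i using PiE_arb[OF x that] .
    show "x \<in> f ` (A \<times> A) \<union> g ` (A \<times> A)"
    proof (cases "x 1 = x 3")
      case same: True
      have "x i = f (x 1, x 2) i" for i
      proof (cases "i \<in> {1..4}")
        case i: True
        then consider "i = 1" | "i = 2" | "i = 3" | "i = 4" unfolding set4 by blast
        then show ?thesis using same eq by cases (auto simp: f_def)
      qed (auto simp: undef f_def)
      then have "x = f (x 1, x 2)" ..
      then show ?thesis using mem by blast
    next
      case False
      then have eq': "x 1 = x 4 \<and> x 3 = x 2"
        using sidonD[OF S, of "x 1" "x 3" "x 4" "x 2"] eq mem A(1) by auto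
      have "x i = g (x 1, x 2) i" for i
      proof (cases "i \<in> {1..4}")
        case i: True
        then consider "i = 1" | "i = 2" | "i = 3" | "i = 4" unfolding set4 by blast
        then show ?thesis using eq' by cases (auto simp: g_def)
      qed (auto simp: undef g_def)
      then have "x = g (x 1, x 2)" ..
      then show ?thesis using mem by blast
    qed
  qed
  then have "card (sols 4 (\<lambda>i. if i \<le> 2 then d else - d) A) \<le> card (f ` (A \<times> A) \<union> g ` (A \<times> A))"
    using A(2) by (intro card_mono) auto
  also have "\<dots> \<le> card (f ` (A \<times> A)) + card (g ` (A \<times> A))" by (rule card_Un_le)
  also have "\<dots> \<le> card (A \<times> A) + card (A \<times> A)" using A(2) by (intro add_mono card_image_le) auto
  finally show ?thesis by (simp add: card_cartesian_product power2_eq_square)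
qed

text \<open>The fourth moment is \<open>M\<close> times the additive energy. The dilation
  \<open>d\<close> later runs through the coefficients of the equation.\<close>

lemma sidon_fourth_moment:
  assumes S: "sidon S" and A: "A \<subseteq> S" "finite A" and d: "d \<noteq> 0"
    and L: "\<And>x. x \<in> A \<Longrightarrow> \<bar>x\<bar> \<le> L" and M: "4 * L * \<bar>d\<bar> < int M" "M > 0"
  shows "(\<Sum>k<M. norm (fsum M A (\<lambda>_. 1) (d * int k)) ^ 4) \<le> 2 * real M * real (card A) ^ 2"
proof -
  define e where "e i = (if i \<le> (2::nat) then d else - d)" for i
  have set4: "{1..4::nat} = {1, 2, 3, 4}" by auto
  have sum_e: "(\<Sum>i=1..4. \<bar>e i\<bar>) = 4 * \<bar>d\<bar>" unfolding set4 by (simp add: e_def)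
  have cnj: "fsum M A (\<lambda>_. 1) (- k) = cnj (fsum M A (\<lambda>_. 1) k)" for k
    by (simp add: fsum_def flip: ee_minus)
  have "(\<Prod>i=1..4. fsum M A (\<lambda>_. 1) (e i * int k)) = of_real (norm (fsum M A (\<lambda>_. 1) (d * int k)) ^ 4)" for k
  proof -
    define z where "z = fsum M A (\<lambda>_. 1) (d * int k)"
    have "(\<Prod>i=1..4. fsum M A (\<lambda>_. 1) (e i * int k)) = (z * cnj z) ^ 2"
      unfolding set4 by (simp add: e_def z_def cnj power2_eq_square mult_ac)
    also have "\<dots> = of_real (norm z ^ 4)"
      by (simp flip: complex_norm_square power_mult add: power_mult[symmetric])
    finally show ?thesis by (simp add: z_def)
  qed
  then have "of_real (\<Sum>k<M. norm (fsum M A (\<lambda>_. 1) (d * int k)) ^ 4) =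
      (\<Sum>k<M. \<Prod>i=1..4. fsum M A (\<lambda>_. 1) (e i * int k))" by simp
  also have "\<dots> = of_nat M * of_real (\<Sum>x\<in>sols 4 e A. \<Prod>i=1..4::nat. 1)"
    by (rule fsum_count[OF A(2) L]) (use M in \<open>simp_all only: sum_e mult_ac\<close>)
  also have "\<dots> = of_real (real M * real (card (sols 4 e A)))" by simp
  finally have "(\<Sum>k<M. norm (fsum M A (\<lambda>_. 1) (d * int k)) ^ 4) = real M * real (card (sols 4 e A))"
    unfolding of_real_eq_iff .
  moreover have "card (sols 4 e A) \<le> 2 * card A ^ 2"
    using card_sidon_sols[OF S A d] by (simp add: e_def[abs_def])
  then have "real (card (sols 4 e A)) \<le> 2 * real (card A) ^ 2"
    by (metis of_nat_le_iff of_nat_mult of_nat_numeral of_nat_power)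
  then have "real M * real (card (sols 4 e A)) \<le> real M * (2 * real (card A) ^ 2)"
    by (rule mult_left_mono) simp
  ultimately show ?thesis by simp
qed

text \<open>A crude form of the inequality of the means: every factor is at most the largest one,
  whose power is among the summands.\<close>

lemma prod_le_sum_power:
  fixes f :: "'a \<Rightarrow> real"
  assumes "finite J" "J \<noteq> {}" "\<And>j. j \<in> J \<Longrightarrow> 0 \<le> f j"
  shows "prod f J \<le> (\<Sum>j\<in>J. f j ^ card J)"
proof -
  have "Max (f ` J) \<in> f ` J" using assms by (intro Max_in) simp_all
  then obtain m where m: "Max (f ` J) = f m" "m \<in> J" by (rule imageE)
  have "f j \<le> f m" if "j \<in> J" for j
    unfolding m(1)[symmetric] using assms(1) that by (intro Max_ge) simp_all
  then have "prod f J \<le> (\<Prod>j\<in>J. f m)"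
    using assms by (intro prod_mono) simp
  also have "\<dots> = f m ^ card J" by simp
  also have "\<dots> \<le> (\<Sum>j\<in>J. f j ^ card J)"
    using assms m(2) by (intro member_le_sum) simp_all
  finally show ?thesis .
qed

section \<open>Bohr sets by pigeonholing\<close>

lemma norm_cis_minus_1_le: "norm (cis t - 1) \<le> \<bar>t\<bar>"
proof -
  have "norm (cis t - 1) ^ 2 = (cos t - 1)\<^sup>2 + (sin t)\<^sup>2" by (simp add: cmod_power2)
  also have "\<dots> = 2 - 2 * cos (2 * (t / 2))"
    using sin_cos_squared_add[of t] by (simp add: power2_eq_square algebra_simps)
  also have "\<dots> = (2 * \<bar>sin (t / 2)\<bar>) ^ 2" unfolding cos_double_sin by simp
  also have "\<dots> \<le> \<bar>t\<bar> ^ 2"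
    using abs_sin_x_le_abs_x[of "t / 2"] by (intro power_mono) auto
  finally show ?thesis by (rule power2_le_imp_le) simp
qed

text \<open>Dirichlet's argument: the fractional parts of \<open>k * n / M\<close> sort the points
  \<open>n\<close> up to \<open>L\<close> into \<open>J ^ card K\<close> cells. A cell of at least
  average size, translated by one of its own points, serves as \<open>B\<close>.\<close>

lemma bohr_set:
  assumes K: "finite K" and J: "0 < J"
  obtains B where "B \<subseteq> {- int L..int L}" "L < card B * J ^ card K"
    "\<And>b k. b \<in> B \<Longrightarrow> k \<in> K \<Longrightarrow> norm (ee M (k * b) - 1) \<le> 2 * pi / real J"
proof -
  define \<theta> where "\<theta> k n = real_of_int k * real n / real M" for k :: int and n :: nat
  define \<phi> where "\<phi> n = (\<lambda>k\<in>K. \<lfloor>real J * frac (\<theta> k n)\<rfloor>)" for n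
  define Y where "Y = (K \<rightarrow>\<^sub>E {0..<int J})"
  define fib where "fib y = {n \<in> {..L}. \<phi> n = y}" for y
  have Y: "finite Y" "card Y = J ^ card K"
    using K by (auto simp: Y_def card_PiE intro: finite_PiE)
  have "\<phi> ` {..L} \<subseteq> Y"
  proof (clarify, unfold Y_def \<phi>_def, intro restrict_PiE_iff[THEN iffD2] ballI)
    fix n k
    have "real J * frac (\<theta> k n) < real J * 1"
      using J frac_lt_1 by (intro mult_strict_left_mono) auto
    then show "\<lfloor>real J * frac (\<theta> k n)\<rfloor> \<in> {0..<int J}"
      by (auto simp: floor_less_iff)
  qed
  then have "(\<Sum>y\<in>Y. card (fib y)) = Suc L"
    using sum.group[of "{..L}" Y \<phi> "\<lambda>_. 1::nat"] Y by (simp add: fib_def)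
  moreover have "\<exists>y\<in>Y. L < card (fib y) * card Y"
  proof (rule ccontr)
    assume "\<not> ?thesis"
    then have "(\<Sum>y\<in>Y. card (fib y) * card Y) \<le> (\<Sum>y\<in>Y. L)" by (intro sum_mono) auto
    then have "(\<Sum>y\<in>Y. card (fib y)) * card Y \<le> L * card Y"
      by (simp add: sum_distrib_right mult.commute[of L])
    then have "Suc L * card Y \<le> L * card Y"
      unfolding \<open>(\<Sum>y\<in>Y. card (fib y)) = Suc L\<close> .
    then show False using Y J by simp
  qed
  ultimately obtain y where y: "L < card (fib y) * card Y" by blast
  then have "fib y \<noteq> {}" by auto
  then obtain n0 where n0: "n0 \<in> fib y" by blast
  define B where "B = (\<lambda>n. int n - int n0) ` fib y"
  have "card B = card (fib y)" unfolding B_def by (intro card_image) (auto simp: inj_on_def)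
  moreover have "B \<subseteq> {- int L..int L}" using n0 by (auto simp: B_def fib_def)
  moreover have "norm (ee M (k * b) - 1) \<le> 2 * pi / real J" if b: "b \<in> B" and k: "k \<in> K" for b k
  proof -
    obtain n where n: "n \<in> fib y" "b = int n - int n0" using b by (auto simp: B_def)
    define \<delta> where "\<delta> = frac (\<theta> k n) - frac (\<theta> k n0)"
    have "\<phi> n k = \<phi> n0 k" using n n0 by (simp add: fib_def)
    then have "\<lfloor>real J * frac (\<theta> k n)\<rfloor> = \<lfloor>real J * frac (\<theta> k n0)\<rfloor>" using k by (simp add: \<phi>_def)
    then have "\<bar>real J * frac (\<theta> k n) - real J * frac (\<theta> k n0)\<bar> < 1" by linarith
    then have "real J * \<bar>\<delta>\<bar> < 1" by (simp add: \<delta>_def abs_mult flip: right_diff_distrib)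
    then have \<delta>: "\<bar>\<delta>\<bar> \<le> 1 / real J" using J by (simp add: field_simps)
    have "2 * pi * real_of_int (k * b) / real M =
        2 * pi * \<delta> + 2 * pi * real_of_int (\<lfloor>\<theta> k n\<rfloor> - \<lfloor>\<theta> k n0\<rfloor>)"
      by (simp add: \<delta>_def frac_def n(2) \<theta>_def algebra_simps diff_divide_distrib)
    then have "ee M (k * b) = cis (2 * pi * \<delta>)"
      unfolding ee_def by (simp only: cis_mult[symmetric]) (simp del: of_int_diff)
    then have "norm (ee M (k * b) - 1) \<le> 2 * pi * \<bar>\<delta>\<bar>"
      using norm_cis_minus_1_le[of "2 * pi * \<delta>"] by (simp add: abs_mult)
    also have "\<dots> \<le> 2 * pi * (1 / real J)" using \<delta> by (intro mult_left_mono) auto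
    finally show ?thesis by simp
  qed
  ultimately show ?thesis using that y Y(2) by metis
qed

section \<open>Smoothing Sidon sets\<close>

text \<open>The convolution of the indicator function of \<open>A\<close> with the uniform
  probability measure on \<open>B\<close>.\<close>

definition smooth :: "int set \<Rightarrow> int set \<Rightarrow> int \<Rightarrow> real" where
  "smooth B A x = (\<Sum>b\<in>B. indicator A (x - b)) / real (card B)"

lemma smooth_nonneg: "0 \<le> smooth B A x"
  by (simp add: smooth_def sum_nonneg)

lemma smooth_sum:
  fixes f :: "int \<Rightarrow> 'a::real_field"
  assumes "finite X" "finite A" "\<And>a b. a \<in> A \<Longrightarrow> b \<in> B \<Longrightarrow> a + b \<in> X"
  shows "(\<Sum>x\<in>X. of_real (smooth B A x) * f x) = (\<Sum>b\<in>B. \<Sum>a\<in>A. f (a + b)) / of_nat (card B)"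
proof -
  have inner: "(\<Sum>x\<in>X. of_real (indicator A (x - b)) * f x) = (\<Sum>a\<in>A. f (a + b))" if "b \<in> B" for b
  proof -
    have "(\<Sum>x\<in>X. of_real (indicator A (x - b)) * f x) =
        (\<Sum>x\<in>(\<lambda>a. a + b) ` A. of_real (indicator A (x - b)) * f x)"
    proof (rule sum.mono_neutral_right)
      show "\<forall>x\<in>X - (\<lambda>a. a + b) ` A. of_real (indicator A (x - b)) * f x = 0"
      proof
        fix x assume "x \<in> X - (\<lambda>a. a + b) ` A"
        then have "x - b \<notin> A" by (auto simp: image_iff)
        then show "of_real (indicator A (x - b)) * f x = 0" by simp
      qed
    qed (use assms that in auto)
    also have "\<dots> = (\<Sum>a\<in>A. f (a + b))" by (subst sum.reindex) (auto simp: inj_on_def)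
    finally show ?thesis .
  qed
  have "(\<Sum>x\<in>X. of_real (smooth B A x) * f x) =
      (\<Sum>x\<in>X. \<Sum>b\<in>B. of_real (indicator A (x - b)) * f x) / of_nat (card B)"
    by (simp add: smooth_def sum_divide_distrib sum_distrib_right)
  also have "\<dots> = (\<Sum>b\<in>B. \<Sum>x\<in>X. of_real (indicator A (x - b)) * f x) / of_nat (card B)"
    by (subst sum.swap) (rule refl)
  finally show ?thesis by (simp add: inner)
qed

text \<open>The Fourier transform of the uniform probability measure on \<open>B\<close>.\<close>

definition fmean :: "nat \<Rightarrow> int set \<Rightarrow> int \<Rightarrow> complex" where
  "fmean M B k = (\<Sum>b\<in>B. ee M (k * b)) / of_nat (card B)"

text \<open>Convolution turns into multiplication, provided that \<open>X\<close> contains the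
  sumset of \<open>A\<close> and \<open>B\<close>.\<close>

lemma fsum_smooth:
  assumes "finite X" "finite A" "\<And>a b. a \<in> A \<Longrightarrow> b \<in> B \<Longrightarrow> a + b \<in> X"
  shows "fsum M X (smooth B A) k = fsum M A (\<lambda>_. 1) k * fmean M B k"
proof -
  have "fsum M X (smooth B A) k = (\<Sum>b\<in>B. \<Sum>a\<in>A. ee M (k * (a + b))) / of_nat (card B)"
    unfolding fsum_def by (rule smooth_sum[OF assms])
  also have "\<dots> = (\<Sum>a\<in>A. \<Sum>b\<in>B. ee M (k * a) * ee M (k * b)) / of_nat (card B)"
    by (subst sum.swap) (simp add: distrib_left ee_add)
  finally show ?thesis by (simp add: fsum_def fmean_def sum_product)
qed

lemma norm_fmean_minus_le:
  assumes "finite B" "B \<noteq> {}" "\<And>b. b \<in> B \<Longrightarrow> norm (ee M (k * b) - 1) \<le> t"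
  shows "norm (1 - fmean M B k) \<le> t"
proof -
  have cB: "card B > 0" using assms by (simp add: card_gt_0_iff)
  have "fmean M B k - 1 = (\<Sum>b\<in>B. ee M (k * b) - 1) / of_nat (card B)"
    using cB by (simp add: fmean_def sum_subtractf diff_divide_distrib)
  then have "norm (1 - fmean M B k) = norm (\<Sum>b\<in>B. ee M (k * b) - 1) / real (card B)"
    by (metis norm_divide norm_minus_commute norm_of_nat)
  also have "norm (\<Sum>b\<in>B. ee M (k * b) - 1) \<le> (\<Sum>b\<in>B. t)"
    by (intro sum_norm_le assms)
  finally show ?thesis using cB by (simp add: divide_right_mono field_simps)
qed

lemma norm_fmean_le_1: "norm (fmean M B k) \<le> 1"
proof -
  have "norm (\<Sum>b\<in>B. ee M (k * b)) \<le> (\<Sum>b\<in>B. 1)" by (intro sum_norm_le) simp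
  then show ?thesis by (cases "card B = 0") (simp_all add: fmean_def norm_divide)
qed

lemma fmean_mod: "M > 0 \<Longrightarrow> fmean M B (k mod int M) = fmean M B k"
  by (simp add: fmean_def ee_mod)

text \<open>Factor \<open>i\<close> is paired with the weight \<open>w\<close>, four further factors
  are bounded by fourth powers, and the other \<open>s - 5\<close> by \<open>U\<close>. This is why
  five variables are required.\<close>

lemma prod_fourth_power_bound:
  fixes f :: "nat \<Rightarrow> real"
  assumes s: "5 \<le> s" and i: "i \<in> {1..s}" and f: "\<And>l. 0 \<le> f l" "\<And>l. f l \<le> U"
    and fi: "f i * w \<le> t" and "0 \<le> w"
  shows "(\<Prod>l=1..s. f l) * w \<le> t * U ^ (s - 5) * (\<Sum>l=1..s. f l ^ 4)"
proof -
  have "4 \<le> card ({1..s} - {i})" using s i by (simp add: card_Diff_singleton)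
  then obtain J where J: "J \<subseteq> {1..s} - {i}" "card J = 4" "finite J"
    by (rule obtain_subset_with_card_n)
  define R where "R = {1..s} - {i} - J"
  have cR: "card R = s - 5" unfolding R_def using J i by (simp add: card_Diff_subset)
  have t: "0 \<le> t" using fi f(1) \<open>0 \<le> w\<close> by (meson mult_nonneg_nonneg order_trans)
  have U: "0 \<le> U" using f order_trans by blast
  have "(\<Prod>l=1..s. f l) = f i * (\<Prod>l\<in>{1..s} - {i}. f l)" using i by (simp add: prod.remove)
  also have "(\<Prod>l\<in>{1..s} - {i}. f l) = prod f R * prod f J"
    unfolding R_def using J by (intro prod.subset_diff) auto
  finally have "(\<Prod>l=1..s. f l) * w = (f i * w) * (prod f R * prod f J)" by (simp add: mult_ac)
  also have "\<dots> \<le> t * (U ^ (s - 5) * (\<Sum>l=1..s. f l ^ 4))"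
  proof (intro mult_mono fi t)
    show "prod f R \<le> U ^ (s - 5)"
      using prod_mono[of R f "\<lambda>_. U"] f cR by simp
    have "J \<noteq> {}" using J(2) by auto
    then have "prod f J \<le> (\<Sum>l\<in>J. f l ^ 4)" using prod_le_sum_power[of J f] J f by simp
    also have "\<dots> \<le> (\<Sum>l=1..s. f l ^ 4)" using J by (intro sum_mono2) auto
    finally show "prod f J \<le> (\<Sum>l=1..s. f l ^ 4)" .
  qed (use f U in \<open>auto intro!: mult_nonneg_nonneg prod_nonneg sum_nonneg\<close>)
  finally show ?thesis by (simp add: mult.assoc)
qed

text \<open>Both counts are Fourier sums modulo \<open>M\<close>. Telescoping the product of the
  \<open>m i k\<close>, which are bounded by 1, leaves terms with one factor
  \<open>1 - m i k\<close>; \<open>prod_fourth_power_bound\<close> and the fourth moment estimate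
  then apply.\<close>

lemma transference:
  assumes S: "sidon S" "A \<subseteq> S" and A: "A \<subseteq> {1..int N}" and B: "B \<subseteq> {- int N..int N}"
    and s: "5 \<le> s" and c: "\<And>i. i \<in> {1..s} \<Longrightarrow> c i \<noteq> 0"
    and M: "4 * int N * (\<Sum>i=1..s. \<bar>c i\<bar>) < int M" "M > 0"
    and cA: "real (card A) \<le> U"
    and H: "\<And>k. k < M \<Longrightarrow> norm (fsum M A (\<lambda>_. 1) (int k)) * norm (1 - fmean M B (int k)) \<le> t"
  shows "\<bar>real (card (sols s c A)) - (\<Sum>x\<in>sols s c {- 2 * int N..2 * int N}. \<Prod>i=1..s. smooth B A (x i))\<bar>
    \<le> 2 * real s ^ 2 * t * U ^ (s - 3)"
proof -
  define F where "F i k = fsum M A (\<lambda>_. 1) (c i * int k)" for i k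
  define m where "m i k = fmean M B (c i * int k)" for i k
  define X where "X = {- 2 * int N..2 * int N}"
  define TA where "TA = real (card (sols s c A))"
  define Tg where "Tg = (\<Sum>x\<in>sols s c X. \<Prod>i=1..s. smooth B A (x i))"
  have finA: "finite A" using A finite_subset by blast
  have csum: "0 \<le> (\<Sum>i=1..s. \<bar>c i\<bar>)" by (simp add: sum_nonneg)
  have AX: "a + b \<in> X" if "a \<in> A" "b \<in> B" for a b
  proof -
    have "a \<in> {1..int N}" "b \<in> {- int N..int N}" using that A B by blast+
    then show ?thesis by (simp add: X_def)
  qed
  have L: "int N * (\<Sum>i=1..s. \<bar>c i\<bar>) < int M" "2 * int N * (\<Sum>i=1..s. \<bar>c i\<bar>) < int M"
    using M(1) mult_nonneg_nonneg[OF of_nat_0_le_iff[of N] csum] by linarith+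
  have A_eq: "(\<Sum>k<M. \<Prod>i=1..s. F i k) = of_real (real M * TA)"
  proof -
    have "(\<Sum>k<M. \<Prod>i=1..s. F i k) = of_nat M * of_real (\<Sum>x\<in>sols s c A. \<Prod>i=1..s. 1)"
      unfolding F_def by (rule fsum_count[OF finA _ L(1) M(2)]) (use A in auto)
    then show ?thesis by (simp add: TA_def)
  qed
  have g_eq: "(\<Sum>k<M. \<Prod>i=1..s. F i k * m i k) = of_real (real M * Tg)"
  proof -
    have "(\<Sum>k<M. \<Prod>i=1..s. fsum M X (smooth B A) (c i * int k)) = of_nat M * of_real Tg"
      unfolding Tg_def by (rule fsum_count[OF _ _ L(2) M(2)]) (auto simp: X_def)
    moreover have "fsum M X (smooth B A) k = fsum M A (\<lambda>_. 1) k * fmean M B k" for k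
      by (rule fsum_smooth) (auto simp: finA AX, simp add: X_def)
    ultimately show ?thesis by (simp add: F_def m_def)
  qed
  have FU: "norm (F i k) \<le> U" for i k
  proof -
    have "norm (F i k) \<le> (\<Sum>a\<in>A. 1)" unfolding F_def fsum_def by (intro sum_norm_le) simp
    then show ?thesis using cA by simp
  qed
  have H': "norm (F i k) * norm (1 - m i k) \<le> t" for i k
  proof -
    \<comment> \<open>The hypothesis \<open>H\<close> concerns frequencies below \<open>M\<close>,
      so \<open>c i * int k\<close> is first reduced modulo \<open>M\<close>.\<close>
    define q where "q = nat (c i * int k mod int M)"
    have q: "int q = c i * int k mod int M" "q < M" using M(2) by (simp_all add: q_def nat_less_iff)
    show ?thesis using H[OF q(2)] unfolding q(1) F_def m_def fsum_mod[OF M(2)] fmean_mod[OF M(2)] .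
  qed
  have t: "0 \<le> t" using H' mult_nonneg_nonneg order_trans by (meson norm_ge_zero)
  have U: "0 \<le> U" using FU norm_ge_zero order_trans by blast
  have "of_real (real M * (TA - Tg)) = (\<Sum>k<M. (\<Prod>i=1..s. F i k) * (1 - (\<Prod>i=1..s. m i k)))"
    using A_eq g_eq by (simp add: prod.distrib right_diff_distrib sum_subtractf)
  then have "norm (complex_of_real (real M * (TA - Tg))) \<le>
      (\<Sum>k<M. norm ((\<Prod>i=1..s. F i k) * (1 - (\<Prod>i=1..s. m i k))))"
    by (simp only: norm_sum)
  then have "real M * \<bar>TA - Tg\<bar> \<le> (\<Sum>k<M. norm ((\<Prod>i=1..s. F i k) * (1 - (\<Prod>i=1..s. m i k))))"
    by (simp only: norm_of_real abs_mult abs_of_nat)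
  also have "\<dots> \<le> (\<Sum>k<M. \<Sum>i=1..s. (\<Prod>l=1..s. norm (F l k)) * norm (1 - m i k))"
  proof (intro sum_mono)
    fix k
    have "norm ((\<Prod>i=1..s. 1) - (\<Prod>i=1..s. m i k)) \<le> (\<Sum>i=1..s. norm (1 - m i k))"
      by (rule norm_prod_diff) (simp_all add: m_def norm_fmean_le_1)
    then have "(\<Prod>l=1..s. norm (F l k)) * norm (1 - (\<Prod>i=1..s. m i k)) \<le>
        (\<Prod>l=1..s. norm (F l k)) * (\<Sum>i=1..s. norm (1 - m i k))"
      by (intro mult_left_mono) (simp_all add: prod_nonneg)
    then show "norm ((\<Prod>i=1..s. F i k) * (1 - (\<Prod>i=1..s. m i k))) \<le>
        (\<Sum>i=1..s. (\<Prod>l=1..s. norm (F l k)) * norm (1 - m i k))"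
      by (simp add: norm_mult prod_norm sum_distrib_left)
  qed
  also have "\<dots> \<le> (\<Sum>k<M. \<Sum>i=1..s. t * U ^ (s - 5) * (\<Sum>l=1..s. norm (F l k) ^ 4))"
  proof (intro sum_mono)
    fix k i assume i: "i \<in> {1..s}"
    show "(\<Prod>l=1..s. norm (F l k)) * norm (1 - m i k) \<le> t * U ^ (s - 5) * (\<Sum>l=1..s. norm (F l k) ^ 4)"
      by (rule prod_fourth_power_bound[OF s i, where f = "\<lambda>l. norm (F l k)"]) (simp_all add: H' FU)
  qed
  also have "\<dots> = real s * (t * U ^ (s - 5)) * (\<Sum>k<M. \<Sum>l=1..s. norm (F l k) ^ 4)"
    by (simp add: mult.assoc flip: sum_distrib_left)
  also have "\<dots> = real s * (t * U ^ (s - 5)) * (\<Sum>l=1..s. \<Sum>k<M. norm (F l k) ^ 4)"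
    by (subst sum.swap) (rule refl)
  also have "\<dots> \<le> real s * (t * U ^ (s - 5)) * (\<Sum>l=1..s. 2 * real M * U ^ 2)"
  proof (intro mult_left_mono sum_mono)
    fix l assume l: "l \<in> {1..s}"
    have "4 * int N * \<bar>c l\<bar> \<le> 4 * int N * (\<Sum>i=1..s. \<bar>c i\<bar>)"
      using l by (intro mult_left_mono member_le_sum) auto
    then have "(\<Sum>k<M. norm (F l k) ^ 4) \<le> 2 * real M * real (card A) ^ 2"
      unfolding F_def
      by (intro sidon_fourth_moment[OF S finA c[OF l], where L = "int N"]) (use A M in auto)
    also have "\<dots> \<le> 2 * real M * U ^ 2" by (intro mult_left_mono power_mono cA) auto
    finally show "(\<Sum>k<M. norm (F l k) ^ 4) \<le> 2 * real M * U ^ 2" .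
  qed (use t U in auto)
  also have "\<dots> = real M * (2 * real s ^ 2 * t * (U ^ (s - 5) * U ^ 2))"
    by (simp add: power2_eq_square)
  also have "U ^ (s - 5) * U ^ 2 = U ^ (s - 3)"
  proof -
    have "s - 3 = (s - 5) + 2" using s by simp
    then show ?thesis by (simp only: power_add)
  qed
  finally have "\<bar>TA - Tg\<bar> \<le> 2 * real s ^ 2 * t * U ^ (s - 3)" using M(2) by simp
  then show ?thesis by (simp add: TA_def Tg_def X_def)
qed

section \<open>The second moment of a smoothed Sidon set\<close>

lemma card_sidon_shift:
  assumes "sidon S" "finite S" "d \<noteq> 0"
  shows "card {a \<in> S. a + d \<in> S} \<le> 1"
proof -
  have "a = a'" if "a \<in> {a \<in> S. a + d \<in> S}" "a' \<in> {a \<in> S. a + d \<in> S}" for a a'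
    using sidonD[OF assms(1), of "a + d" a "a' + d" a'] that assms(3) by auto
  then show ?thesis using assms(2) by (auto simp: card_le_Suc0_iff_eq)
qed

text \<open>The Erdos-Turan argument works for averages over an arbitrary set \<open>B\<close>, not only over intervals.\<close>
lemma smooth_sidon_square_sum:
  assumes S: "sidon S" "finite S" and B: "finite B" "B \<noteq> {}" and X: "finite X"
    and SX: "\<And>a b. a \<in> S \<Longrightarrow> b \<in> B \<Longrightarrow> a + b \<in> X"
  shows "(\<Sum>x\<in>X. smooth B S x ^ 2) \<le> real (card S) / real (card B) + 1"
proof -
  define \<beta> where "\<beta> = real (card B)"
  have \<beta>: "\<beta> > 0" using B by (simp add: \<beta>_def card_gt_0_iff)
  have "(\<Sum>x\<in>X. smooth B S x ^ 2) = (\<Sum>b\<in>B. \<Sum>a\<in>S. smooth B S (a + b)) / \<beta>"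
    using smooth_sum[OF X S(2) SX, where f = "smooth B S"] by (simp add: power2_eq_square \<beta>_def)
  also have "\<dots> = (\<Sum>b\<in>B. \<Sum>b'\<in>B. \<Sum>a\<in>S. indicator S (a + (b - b'))) / \<beta> / \<beta>"
    by (simp add: smooth_def \<beta>_def sum_divide_distrib sum.swap[of _ S] algebra_simps)
  \<comment> \<open>The diagonal \<open>b' = b\<close> contributes \<open>card S\<close> each time;
    for any other pair the Sidon property admits at most one \<open>a\<close>.\<close>
  also have "\<dots> \<le> (\<Sum>b\<in>B. \<Sum>b'\<in>B. (if b' = b then real (card S) else 0) + 1) / \<beta> / \<beta>"
  proof (intro divide_right_mono sum_mono)
    fix b b'
    have "(\<Sum>a\<in>S. indicator S (a + (b - b'))) = real (card {a \<in> S. a + (b - b') \<in> S})"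
      using S(2) by (simp add: indicator_def sum.If_cases Int_def)
    also have "\<dots> \<le> (if b' = b then real (card S) else 0) + 1"
      using card_sidon_shift[OF S, of "b - b'"] by auto
    finally show "(\<Sum>a\<in>S. indicator S (a + (b - b'))) \<le> (if b' = b then real (card S) else 0) + 1" .
  qed (use \<beta> in auto)
  also have "\<dots> = (real (card S) + \<beta>) / \<beta>"
    using B by (simp add: sum.distrib \<beta>_def)
  also have "\<dots> = real (card S) / \<beta> + 1" using \<beta> by (simp add: field_simps)
  finally show ?thesis by (simp add: \<beta>_def)
qed

text \<open>Chebyshev's inequality around the value \<open>1 / n\<close>: each sparse point
  contributes at least \<open>(1 / (2 * n)) ^ 2\<close> to the total squared deviation.\<close>

lemma few_sparse_points:
  assumes S: "sidon S" "S \<subseteq> {1..int N}" and B: "B \<noteq> {}" "B \<subseteq> {- int L..int L}" and N: "0 < N"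
    and dense: "real (card S) \<ge> (1 - \<eta>) * sqrt N"
  shows "real (card {x \<in> {1..int N}. smooth B S x < 1 / (2 * sqrt N)}) \<le>
    4 * N * (card S / card B + 2 * \<eta> + 2 * L / N)"
proof -
  define n where "n = sqrt (real N)"
  have n: "n > 0" "n ^ 2 = N" using N by (simp_all add: n_def)
  define X where "X = {1 - int L..int N + int L}"
  define E where "E = {x \<in> {1..int N}. smooth B S x < 1 / (2 * n)}"
  have finS: "finite S" using S(2) finite_subset by blast
  have finB: "finite B" using B(2) finite_subset by blast
  have SX: "a + b \<in> X" if "a \<in> S" "b \<in> B" for a b
  proof -
    have "a \<in> {1..int N}" "b \<in> {- int L..int L}" using that S B by blast+
    then show ?thesis by (simp add: X_def)
  qed
  have finX: "finite X" by (simp add: X_def)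
  have cX: "real (card X) = N + 2 * L" by (simp add: X_def)
  have sq: "(\<Sum>x\<in>X. smooth B S x ^ 2) \<le> card S / card B + 1"
    using smooth_sidon_square_sum[OF S(1) finS finB B(1) finX SX] .
  have lin: "(\<Sum>x\<in>X. smooth B S x) = card S"
    using smooth_sum[OF finX finS SX, where f = "\<lambda>_. 1::real"] finB B(1) by (simp add: card_gt_0_iff)
  have "card E * (1 / (4 * n ^ 2)) = (\<Sum>x\<in>E. (1 / (2 * n)) ^ 2)"
    by (simp add: power2_eq_square)
  also have "\<dots> \<le> (\<Sum>x\<in>E. (smooth B S x - 1 / n) ^ 2)"
  proof (intro sum_mono)
    fix x assume "x \<in> E"
    then have "1 / (2 * n) \<le> 1 / n - smooth B S x" using n(1) by (simp add: E_def field_simps)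
    then have "(1 / (2 * n)) ^ 2 \<le> (1 / n - smooth B S x) ^ 2" using n(1) by (intro power_mono) auto
    then show "(1 / (2 * n)) ^ 2 \<le> (smooth B S x - 1 / n) ^ 2" by (simp add: power2_commute)
  qed
  also have "\<dots> \<le> (\<Sum>x\<in>X. (smooth B S x - 1 / n) ^ 2)"
    by (intro sum_mono2 finX) (auto simp: E_def X_def)
  also have "\<dots> = (\<Sum>x\<in>X. smooth B S x ^ 2) - 2 / n * (\<Sum>x\<in>X. smooth B S x) + card X * (1 / n ^ 2)"
    by (simp add: power2_diff sum.distrib sum_subtractf sum_distrib_left sum_divide_distrib power_divide mult_ac)
  \<comment> \<open>The main terms 1, -2 and 1 cancel; what survives comes from the diagonal, the
    defect \<open>\<eta>\<close> in the size of \<open>S\<close>, and the margin of width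
    \<open>L\<close> at both ends.\<close>
  also have "\<dots> \<le> (card S / card B + 1) - 2 / n * ((1 - \<eta>) * n) + (N + 2 * L) * (1 / n ^ 2)"
    unfolding lin cX using sq dense n
    by (intro add_mono diff_mono mult_left_mono) (auto simp: n_def)
  also have "\<dots> = card S / card B + 2 * \<eta> + 2 * L / N"
    using n N by (simp add: field_simps)
  finally have "card E / (4 * N) \<le> card S / card B + 2 * \<eta> + 2 * L / N"
    using n(2) by simp
  then have "card E \<le> (card S / card B + 2 * \<eta> + 2 * L / N) * (4 * N)"
    using N by (subst (asm) pos_divide_le_eq) simp_all
  then show ?thesis by (simp add: E_def n_def mult.commute)
qed

text \<open>The last coordinate is determined by the others because its coefficient is
  non-zero.\<close>

lemma card_sols_le:
  assumes A: "finite A" and s: "1 \<le> s" and c: "c s \<noteq> 0"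
  shows "card (sols s c A) \<le> card A ^ (s - 1)"
proof -
  have "inj_on (\<lambda>x. restrict x {1..<s}) (sols s c A)"
  proof (rule inj_onI)
    fix x y assume xy: "x \<in> sols s c A" "y \<in> sols s c A" and eq: "restrict x {1..<s} = restrict y {1..<s}"
    have low: "x i = y i" if "i \<in> {1..<s}" for i using fun_cong[OF eq, of i] that by simp
    have split: "{1..s} = insert s {1..<s}" using s by auto
    have "(\<Sum>i=1..s. c i * x i) = (\<Sum>i=1..s. c i * y i)" using xy by (simp add: sols_def)
    moreover have "(\<Sum>i\<in>{1..<s}. c i * x i) = (\<Sum>i\<in>{1..<s}. c i * y i)"
      by (intro sum.cong) (simp_all add: low)
    ultimately have "c s * x s = c s * y s" unfolding split by simp
    then have "x s = y s" using c by simp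
    then have "x i = y i" if "i \<in> {1..s}" for i using low that by (cases "i = s") auto
    then show "x = y" using xy unfolding sols_def by (intro PiE_ext[of x "{1..s}" "\<lambda>_. A" y]) auto
  qed
  moreover have "(\<lambda>x. restrict x {1..<s}) ` sols s c A \<subseteq> {1..<s} \<rightarrow>\<^sub>E A"
    by (auto simp: sols_def)
  ultimately have "card (sols s c A) \<le> card ({1..<s} \<rightarrow>\<^sub>E A)"
    using A by (intro card_inj_on_le[of "\<lambda>x. restrict x {1..<s}"] finite_PiE) auto
  then show ?thesis by (simp add: card_PiE)
qed

text \<open>The product of indicators is 1 on \<open>sols\<close> and 0 on all other tuples, so the
  infinite sum reduces to a finite count.\<close>

lemma solution_sum_eq_card:
  assumes A: "finite A"
  shows "solution_sum s c A = card (sols s c A)"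
proof -
  have "solution_sum s c A = (\<Sum>\<^sub>\<infinity>x\<in>sols s c A. 1)"
    unfolding solution_sum_def
  proof (rule infsum_cong_neutral)
    fix x assume x: "x \<in> solutions s c - sols s c A"
    have "\<exists>i\<in>{1..s}. x i \<notin> A"
    proof (rule ccontr)
      assume "\<not> ?thesis"
      then have "x \<in> {1..s} \<rightarrow>\<^sub>E A" using x by (auto simp: solutions_def PiE_iff)
      then show False using x by (simp add: sols_def solutions_def)
    qed
    then show "(\<Prod>i=1..s. indicator A (x i)) = (0::real)" by (intro prod_zero) (auto simp: indicator_def)
  next
    fix x assume "x \<in> solutions s c \<inter> sols s c A"
    then have x: "x \<in> {1..s} \<rightarrow>\<^sub>E A" unfolding sols_def by blast
    have "x i \<in> A" if "i \<in> {1..s}" for i using PiE_mem[OF x that] .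
    then show "(\<Prod>i=1..s. indicator A (x i)) = (1::real)" by simp
  next
    fix x assume "x \<in> sols s c A - solutions s c"
    then show "(1::real) = 0" by (auto simp: sols_def solutions_def PiE_iff)
  qed
  then show ?thesis using finite_sols[OF A, of s c] by simp
qed

section \<open>Partition regularity over dense Sidon sets\<close>

text \<open>\<open>B\<close> is a Bohr set for the large spectra of all colour classes. On the
  spectrum the bounds \<open>2 * n\<close> and \<open>\<epsilon> / 2\<close> multiply to
  \<open>\<epsilon> * n\<close>, off the spectrum \<open>\<epsilon> * n / 2\<close> and 2 do;
  \<open>J\<close> makes the phases accurate to \<open>\<epsilon> / 2\<close>.\<close>

lemma bohr_set_for_colouring:
  fixes \<epsilon> n :: real and r N L Q :: nat
  defines "n \<equiv> sqrt N"
  defines "J \<equiv> nat \<lceil>4 * pi / \<epsilon>\<rceil> + 1" and "\<kappa> \<equiv> r * nat \<lfloor>128 * Q / \<epsilon> ^ 4\<rfloor>"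
  assumes S: "sidon S" "S \<subseteq> {1..int N}" and N: "0 < N" and \<epsilon>: "0 < \<epsilon>" and Q: "4 < Q"
    and cS: "card S \<le> 2 * n" and C: "\<And>j. j \<in> {1..r} \<Longrightarrow> C j \<subseteq> S"
  obtains B where "B \<subseteq> {- int L..int L}" "L < card B * J ^ \<kappa>"
    "\<And>j k. j \<in> {1..r} \<Longrightarrow> k < Q * N \<Longrightarrow>
       norm (fsum (Q * N) (C j) (\<lambda>_. 1) (int k)) * norm (1 - fmean (Q * N) B (int k)) \<le> \<epsilon> * n"
proof -
  define F where "F j k = norm (fsum (Q * N) (C j) (\<lambda>_. 1) (int k))" for j k
  define spec where "spec j = {k \<in> {..<Q * N}. \<epsilon> * n / 2 < F j k}" for j
  have n: "n > 0" "n ^ 2 = N" using N by (simp_all add: n_def)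
  have nn: "n * n = N" using n(2) by (simp add: power2_eq_square)
  have n4: "n ^ 4 = real N ^ 2" using n(2) by (simp flip: n(2) power_mult)
  have finS: "finite S" using S(2) finite_subset by blast
  have cC: "card (C j) \<le> 2 * n" "finite (C j)" if "j \<in> {1..r}" for j
    using C[OF that] finS card_mono[OF finS C[OF that]] cS finite_subset by (fastforce, blast)
  have card_spec: "card (spec j) \<le> nat \<lfloor>128 * Q / \<epsilon> ^ 4\<rfloor>" if j: "j \<in> {1..r}" for j
  proof -
    have "card (spec j) * (\<epsilon> * n / 2) ^ 4 = (\<Sum>k\<in>spec j. (\<epsilon> * n / 2) ^ 4)" by simp
    also have "\<dots> \<le> (\<Sum>k\<in>spec j. F j k ^ 4)"
      using \<epsilon> n(1) by (intro sum_mono power_mono) (auto simp: spec_def)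
    also have "\<dots> \<le> (\<Sum>k<Q * N. F j k ^ 4)" by (intro sum_mono2) (auto simp: spec_def)
    also have "\<dots> = (\<Sum>k<Q * N. norm (fsum (Q * N) (C j) (\<lambda>_. 1) (1 * int k)) ^ 4)"
      by (simp add: F_def)
    also have "\<dots> \<le> 2 * real (Q * N) * real (card (C j)) ^ 2"
    proof (rule sidon_fourth_moment[OF S(1) C[OF j] cC(2)[OF j], where L = "int N"])
      have "4 * N < Q * N" using Q N by simp
      then have "int (4 * N) < int (Q * N)" by (simp only: of_nat_less_iff)
      then show "4 * int N * \<bar>1\<bar> < int (Q * N)" by simp
      show "\<bar>x\<bar> \<le> int N" if "x \<in> C j" for x
      proof -
        have "x \<in> {1..int N}" using that C[OF j] S(2) by blast
        then show ?thesis by simp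
      qed
    qed (use Q N in auto)
    also have "\<dots> \<le> 2 * real (Q * N) * (2 * n) ^ 2"
      using cC(1)[OF j] by (intro mult_left_mono power_mono) auto
    \<comment> \<open>With \<open>n ^ 2 = N\<close> the left side is \<open>8 * Q * n ^ 4\<close>,
      and the threshold contributes a further factor 16.\<close>
    also have "\<dots> = 128 * Q / \<epsilon> ^ 4 * (\<epsilon> * n / 2) ^ 4"
      using \<epsilon> by (simp add: power_mult_distrib power_divide n4 nn field_simps power2_eq_square)
    finally have "card (spec j) \<le> 128 * Q / \<epsilon> ^ 4"
      using \<epsilon> n(1) by (simp only: mult_le_cancel_right_pos zero_less_power zero_less_divide_iff mult_pos_pos zero_less_numeral simp_thms)
    then show ?thesis by (simp add: le_nat_floor)
  qed
  define K where "K = (\<Union>j\<in>{1..r}. int ` spec j)"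
  have finK: "finite K" by (auto simp: K_def spec_def)
  have "card K \<le> (\<Sum>j=1..r. card (int ` spec j))" unfolding K_def by (rule card_UN_le) simp
  also have "\<dots> \<le> (\<Sum>j=1..r. nat \<lfloor>128 * Q / \<epsilon> ^ 4\<rfloor>)"
    by (intro sum_mono order_trans[OF card_image_le card_spec]) (auto simp: spec_def)
  finally have cK: "card K \<le> \<kappa>" by (simp add: \<kappa>_def)
  have J: "0 < J" by (simp add: J_def)
  obtain B where B: "B \<subseteq> {- int L..int L}" "L < card B * J ^ card K"
    and Bk: "\<And>b k. b \<in> B \<Longrightarrow> k \<in> K \<Longrightarrow> norm (ee (Q * N) (k * b) - 1) \<le> 2 * pi / real J"
    using bohr_set[OF finK J] by metis
  have finB: "finite B" using B(1) finite_subset by blast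
  have "B \<noteq> {}" using B(2) by auto
  have "2 * pi / J \<le> \<epsilon> / 2"
  proof -
    have "4 * pi / \<epsilon> \<le> J" unfolding J_def by linarith
    then show ?thesis using \<epsilon> J by (simp add: field_simps)
  qed
  then have near: "norm (1 - fmean (Q * N) B k) \<le> \<epsilon> / 2" if "k \<in> K" for k
    using norm_fmean_minus_le[OF finB \<open>B \<noteq> {}\<close> Bk[OF _ that]] by fastforce
  show ?thesis
  proof (rule that[OF B(1)])
    show "L < card B * J ^ \<kappa>"
    proof -
      have "J ^ card K \<le> J ^ \<kappa>" using J cK by (intro power_increasing) auto
      then show ?thesis using B(2) mult_le_mono2 order_less_le_trans by blast
    qed
    fix j k assume j: "j \<in> {1..r}" and k: "k < Q * N"
    have "F j k * norm (1 - fmean (Q * N) B (int k)) \<le> \<epsilon> * n"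
    proof (cases "k \<in> spec j")
      case True
      then have "int k \<in> K" using j by (auto simp: K_def)
      have "F j k \<le> (\<Sum>a\<in>C j. 1)" unfolding F_def fsum_def by (intro sum_norm_le) simp
      then have "F j k \<le> 2 * n" using cC(1)[OF j] by simp
      then have "F j k * norm (1 - fmean (Q * N) B (int k)) \<le> 2 * n * (\<epsilon> / 2)"
        using near[OF \<open>int k \<in> K\<close>] n(1) by (intro mult_mono) auto
      then show ?thesis by (simp add: mult.commute)
    next
      case False
      have "norm (1 - fmean (Q * N) B (int k)) \<le> 2"
        using norm_triangle_ineq4[of 1 "fmean (Q * N) B (int k)"] norm_fmean_le_1[of "Q * N" B "int k"] by simp
      moreover have "F j k \<le> \<epsilon> * n / 2" using False k by (auto simp: spec_def)
      ultimately have "F j k * norm (1 - fmean (Q * N) B (int k)) \<le> \<epsilon> * n / 2 * 2"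
        using \<epsilon> n(1) by (intro mult_mono) auto
      then show ?thesis by simp
    qed
    then show "norm (fsum (Q * N) (C j) (\<lambda>_. 1) (int k)) * norm (1 - fmean (Q * N) B (int k)) \<le> \<epsilon> * n"
      by (simp add: F_def)
  qed
qed

lemma smooth_Union_le:
  assumes "S = (\<Union>j\<in>T. C j)" "finite T"
  shows "smooth B S x \<le> (\<Sum>j\<in>T. smooth B (C j) x)"
proof -
  have "indicator S y \<le> (\<Sum>j\<in>T. indicator (C j) y :: real)" for y
  proof (cases "y \<in> S")
    case True
    then obtain j where "j \<in> T" "y \<in> C j" using assms by blast
    then have "indicator (C j) y = (1::real)" by simp
    then show ?thesis
      using member_le_sum[of j T "\<lambda>j. indicator (C j) y :: real"] \<open>j \<in> T\<close> assms(2) True by simp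
  qed (simp add: sum_nonneg)
  then have "(\<Sum>b\<in>B. indicator S (x - b)) \<le> (\<Sum>b\<in>B. \<Sum>j\<in>T. indicator (C j) (x - b) :: real)"
    by (intro sum_mono)
  also have "\<dots> = (\<Sum>j\<in>T. \<Sum>b\<in>B. indicator (C j) (x - b))" by (rule sum.swap)
  finally show ?thesis by (simp add: smooth_def divide_right_mono flip: sum_divide_distrib)
qed

lemma smooth_solutions_ge:
  fixes a :: real
  assumes "finite X" "A \<subseteq> X" "0 \<le> a" "\<And>x. x \<in> A \<Longrightarrow> a \<le> smooth B D x"
  shows "card (sols s c A) * a ^ s \<le> (\<Sum>x\<in>sols s c X. \<Prod>i=1..s. smooth B D (x i))"
proof -
  have "card (sols s c A) * a ^ s = (\<Sum>x\<in>sols s c A. \<Prod>i=1..s. a)" by simp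
  also have "\<dots> \<le> (\<Sum>x\<in>sols s c A. \<Prod>i=1..s. smooth B D (x i))"
    using assms by (intro sum_mono prod_mono) (auto simp: sols_def dest: PiE_mem)
  also have "\<dots> \<le> (\<Sum>x\<in>sols s c X. \<Prod>i=1..s. smooth B D (x i))"
  proof (rule sum_mono2)
    show "sols s c A \<subseteq> sols s c X" using PiE_mono[of "{1..s}" "\<lambda>_. A" "\<lambda>_. X"] assms(2) by (auto simp: sols_def)
  qed (use assms(1) in \<open>auto intro: finite_sols prod_nonneg smooth_nonneg\<close>)
  finally show ?thesis .
qed

theorem theorem1p15:
  fixes s r :: nat and c :: "nat \<Rightarrow> int"
  assumes "s \<ge> 5"
    and "\<forall>i\<in>{1..s}. c i \<noteq> 0"
    and "\<exists>I. I \<noteq> {} \<and> I \<subseteq> {1..s} \<and> (\<Sum>i\<in>I. c i) = 0"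
    and "r > 0"
  shows "\<exists>N\<^sub>0 \<eta> \<delta> :: real. N\<^sub>0 > 0 \<and> \<eta> > 0 \<and> \<delta> > 0 \<and>
    (\<forall>(N::nat) S. N > 0 \<and> S \<subseteq> {1..int N} \<and> sidon S \<longrightarrow>
      real N \<le> N\<^sub>0 \<or>
      \<bar>real (card S) - sqrt (real N)\<bar> \<ge> \<eta> * sqrt (real N) \<or>
      (\<forall>C. colouring r C S \<longrightarrow>
        (\<exists>j\<in>{1..r}. solution_sum s c (C j) \<ge> \<delta> * real (card S) ^ s / real N)))"
proof -
  obtain I i\<^sub>0 where "I \<subseteq> {1..s}" "i\<^sub>0 \<in> I" "sum c I = 0" using assms(3) by blast
  then interpret regular_equation s c I i\<^sub>0 using assms(2) by unfold_locales auto
  \<comment> \<open>One colour more than \<open>r\<close> is allowed, to accommodate the points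
    where the average of \<open>S\<close> is too small.\<close>
  obtain \<kappa> N\<^sub>1 where \<kappa>: "0 < \<kappa>" and Rado: "\<forall>N\<ge>N\<^sub>1. \<forall>A. {1..int N} \<subseteq> (\<Union>j<Suc r. A j) \<longrightarrow>
      \<kappa> * real N ^ (s - 1) \<le> (\<Sum>j<Suc r. real (card (sols s c (A j \<inter> {1..int N}))))"
    using many_monochromatic_solutions[of "Suc r"] assms(1) by auto
  \<comment> \<open>The exceptional set will have at most \<open>\<gamma> * N\<close> points, hence
    at most half of the guaranteed solutions.\<close>
  define \<gamma> where "\<gamma> = min 1 (\<kappa> / 2)"
  define \<beta> where "\<beta> = \<kappa> / (2 * r) / (2 * r) ^ s"
  \<comment> \<open>Chosen so that the transference error becomes
    \<open>\<beta> / 2 * n ^ (s - 2)\<close>, half of the main term.\<close>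
  define \<epsilon> where "\<epsilon> = \<beta> / (4 * real s ^ 2 * 2 ^ (s - 3))"
  define Q where "Q = nat (4 * (\<Sum>i=1..s. \<bar>c i\<bar>)) + 1"
  define J where "J = nat \<lceil>4 * pi / \<epsilon>\<rceil> + 1"
  define m where "m = r * nat \<lfloor>128 * Q / \<epsilon> ^ 4\<rfloor>"
  \<comment> \<open>For \<open>n\<close> above \<open>\<nu>\<close> the Bohr set has at least
    \<open>16 * n / \<gamma>\<close> elements.\<close>
  define \<nu> where "\<nu> = 16 * J ^ m / (\<gamma> * (\<gamma> / 32))"
  have \<gamma>: "0 < \<gamma>" "\<gamma> \<le> 1" "\<gamma> \<le> \<kappa> / 2" using \<kappa> by (auto simp: \<gamma>_def)
  have \<beta>: "0 < \<beta>" using \<kappa> assms(4) by (simp add: \<beta>_def)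
  have \<epsilon>: "0 < \<epsilon>" using \<beta> assms(1) by (simp add: \<epsilon>_def)
  have "(\<Sum>i=1..s. 1) \<le> (\<Sum>i=1..s. \<bar>c i\<bar>)"
  proof (intro sum_mono)
    fix i assume "i \<in> {1..s}"
    then show "1 \<le> \<bar>c i\<bar>" using nz[of i] by linarith
  qed
  then have Q: "4 < Q" using assms(1) by (simp add: Q_def)
  have J: "0 < J" by (simp add: J_def)
  show ?thesis
  \<comment> \<open>Beyond the threshold \<open>Rado\<close> applies and
    \<open>\<nu> < sqrt N\<close>; the entry 1 makes the threshold positive.\<close>
  proof (rule exI[of _ "max (real N\<^sub>1) (max 1 (\<nu> ^ 2))"], rule exI[of _ "\<gamma> / 32"],
      rule exI[of _ "\<beta> / 2 ^ (s + 1)"], intro conjI allI impI)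
    fix N S assume "0 < N \<and> S \<subseteq> {1..int N} \<and> sidon S"
    then have N: "0 < N" and S: "S \<subseteq> {1..int N}" "sidon S" by auto
    define n where "n = sqrt (real N)"
    have n: "n > 0" "n ^ 2 = N" using N by (simp_all add: n_def)
    have finS: "finite S" using S(1) finite_subset by blast
    have "\<exists>j\<in>{1..r}. \<beta> / 2 ^ (s + 1) * real (card S) ^ s / real N \<le> solution_sum s c (C j)"
      if large: "max (real N\<^sub>1) (max 1 (\<nu> ^ 2)) < N" and near: "\<bar>real (card S) - n\<bar> < \<gamma> / 32 * n"
        and col: "colouring r C S" for C
    proof -
      have N1: "N\<^sub>1 \<le> N" and "\<nu> ^ 2 < n ^ 2" using large n(2) by auto
      then have \<nu>: "\<nu> < n" using n(1) power_less_imp_less_base[of \<nu> 2 n] by simp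
      have SC: "S = (\<Union>j\<in>{1..r}. C j)" using col by (simp add: colouring_def)
      then have CS: "C j \<subseteq> S" if "j \<in> {1..r}" for j using that by blast
      have dense: "(1 - \<gamma> / 32) * n \<le> card S" unfolding left_diff_distrib using near by linarith
      have "\<gamma> / 32 * n \<le> 1 * n" using \<gamma> n(1) by (intro mult_right_mono) auto
      then have cS: "card S \<le> 2 * n" using near by linarith
      \<comment> \<open>The margin is a proportion of \<open>N\<close> small enough for
        \<open>2 * L / N \<le> \<gamma> / 16\<close>; together with \<open>\<gamma> / 8\<close> and
        \<open>2 * (\<gamma> / 32)\<close> this bounds the exceptional set by
        \<open>\<gamma> * N\<close>.\<close>
      define L where "L = nat \<lfloor>\<gamma> / 32 * N\<rfloor>"
      have "0 \<le> \<gamma> / 32 * N" using \<gamma> by simp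
      then have L: "L \<le> \<gamma> / 32 * N" "\<gamma> / 32 * N < L + 1" unfolding L_def by linarith+
      have "\<gamma> / 32 * real N \<le> 1 * real N" using \<gamma> by (intro mult_right_mono) auto
      then have LN: "L \<le> N" using L(1) by simp
      obtain B where B: "B \<subseteq> {- int L..int L}" "L < card B * J ^ m" and H: "\<And>j k. j \<in> {1..r} \<Longrightarrow> k < Q * N \<Longrightarrow>
          norm (fsum (Q * N) (C j) (\<lambda>_. 1) (int k)) * norm (1 - fmean (Q * N) B (int k)) \<le> \<epsilon> * n"
        using bohr_set_for_colouring[where r = r and L = L and C = C,
            OF S(2,1) N \<epsilon> Q cS[unfolded n_def] CS, folded n_def J_def m_def] by metis
      have "B \<noteq> {}" using B(2) by auto
      have BN: "B \<subseteq> {- int N..int N}" using B(1) LN by auto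
      have cB: "16 * n / \<gamma> \<le> card B"
      proof -
        have "16 * n / \<gamma> * J ^ m = \<nu> * n * (\<gamma> / 32)" using \<gamma> by (simp add: \<nu>_def field_simps)
        also have "\<dots> \<le> n * n * (\<gamma> / 32)" using \<nu> n(1) \<gamma> by (intro mult_right_mono) auto
        also have "\<dots> = \<gamma> / 32 * N" using n(2) by (simp add: power2_eq_square)
        also have "\<dots> \<le> real (L + 1)" using L(2) by simp
        also have "\<dots> \<le> real (card B * J ^ m)" using B(2) by (simp only: of_nat_le_iff)
        finally have "16 * n / \<gamma> * real (J ^ m) \<le> real (card B) * real (J ^ m)" by simp
        then show ?thesis by (rule mult_right_le_imp_le) (use J in simp)
      qed
      define E where "E = {x \<in> {1..int N}. smooth B S x < 1 / (2 * n)}"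
      have cE: "card E \<le> \<gamma> * N"
      proof -
        have "card S / card B \<le> 2 * n / (16 * n / \<gamma>)"
          using cS cB n(1) \<gamma> by (intro frac_le) auto
        also have "\<dots> = \<gamma> / 8" using n(1) by simp
        finally have 1: "card S / card B \<le> \<gamma> / 8" .
        have 2: "2 * real L / real N \<le> \<gamma> / 16" using L(1) N by (simp add: field_simps)
        have "card E \<le> 4 * real N * (card S / card B + 2 * (\<gamma> / 32) + 2 * real L / real N)"
          unfolding E_def n_def
          by (rule few_sparse_points[OF S(2,1) \<open>B \<noteq> {}\<close> B(1) N dense[unfolded n_def]])
        also have "\<dots> \<le> 4 * real N * (\<gamma> / 8 + 2 * (\<gamma> / 32) + \<gamma> / 16)"
          using 1 2 by (intro mult_left_mono add_mono) auto
        also have "\<dots> = \<gamma> * N" by simp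
        finally show ?thesis .
      qed
      \<comment> \<open>\<open>E\<close> serves as an extra colour, but is too small to contain many solutions.\<close>
      define A where "A j = (if j = 0 then E
        else {x \<in> {1..int N}. 1 / (2 * r * n) \<le> smooth B (C j) x})" for j
      have "{1..int N} \<subseteq> (\<Union>j<Suc r. A j)"
      proof
        fix x assume x: "x \<in> {1..int N}"
        show "x \<in> (\<Union>j<Suc r. A j)"
        proof (cases "x \<in> E")
          case False
          then have "1 / (2 * n) \<le> smooth B S x" using x by (auto simp: E_def)
          also have "\<dots> \<le> (\<Sum>j=1..r. smooth B (C j) x)" by (rule smooth_Union_le[OF SC]) simp
          finally have ge: "1 / (2 * n) \<le> (\<Sum>j=1..r. smooth B (C j) x)" .
          have "\<exists>j\<in>{1..r}. 1 / (2 * r * n) \<le> smooth B (C j) x"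
          proof (rule ccontr)
            assume "\<not> ?thesis"
            then have "smooth B (C j) x < 1 / (2 * r * n)" if "j \<in> {1..r}" for j
              using that by (meson not_le)
            then have "(\<Sum>j=1..r. smooth B (C j) x) < (\<Sum>j=1..r. 1 / (2 * r * n))"
              using assms(4) by (intro sum_strict_mono) simp_all
            then show False using ge assms(4) by simp
          qed
          then obtain j where "j \<in> {1..r}" "x \<in> A j" using x by (auto simp: A_def)
          then show ?thesis by auto
        qed (auto simp: A_def)
      qed
      then have "\<kappa> * real N ^ (s - 1) \<le> (\<Sum>j<Suc r. real (card (sols s c (A j \<inter> {1..int N}))))"
        using Rado N1 by blast
      also have "\<dots> = (\<Sum>j<Suc r. real (card (sols s c (A j))))"
      proof (rule sum.cong[OF refl])
        fix j have "A j \<inter> {1..int N} = A j" by (auto simp: A_def E_def)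
        then show "real (card (sols s c (A j \<inter> {1..int N}))) = real (card (sols s c (A j)))" by simp
      qed
      also have "\<dots> = card (sols s c E) + (\<Sum>j=1..r. real (card (sols s c (A j))))"
      proof -
        have "{..<Suc r} = insert 0 {1..r}" by auto
        then show ?thesis by (simp add: A_def)
      qed
      finally have total: "\<kappa> * real N ^ (s - 1) \<le>
        card (sols s c E) + (\<Sum>j=1..r. real (card (sols s c (A j))))" .
      have "card (sols s c E) \<le> card E ^ (s - 1)"
      proof (rule card_sols_le)
        show "finite E" unfolding E_def by (rule finite_subset[of _ "{1..int N}"]) auto
      qed (use assms(1) nz[of s] in auto)
      then have "real (card (sols s c E)) \<le> real (card E) ^ (s - 1)"
        by (metis of_nat_le_iff of_nat_power)
      also have "\<dots> \<le> (\<gamma> * N) ^ (s - 1)" by (intro power_mono cE) simp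
      also have "\<dots> = \<gamma> ^ (s - 1) * real N ^ (s - 1)" by (rule power_mult_distrib)
      also have "\<dots> \<le> \<kappa> / 2 * real N ^ (s - 1)"
      proof (rule mult_right_mono)
        have "\<gamma> ^ (s - 1) \<le> \<gamma> ^ 1" using \<gamma> assms(1) by (intro power_decreasing) auto
        then show "\<gamma> ^ (s - 1) \<le> \<kappa> / 2" using \<gamma> by simp
      qed simp
      finally have many: "\<kappa> / 2 * real N ^ (s - 1) \<le> (\<Sum>j=1..r. real (card (sols s c (A j))))"
        using total by simp
      have "\<exists>j\<in>{1..r}. \<kappa> / (2 * r) * real N ^ (s - 1) \<le> card (sols s c (A j))"
      proof (rule ccontr)
        assume "\<not> ?thesis"
        then have "card (sols s c (A j)) < \<kappa> / (2 * r) * real N ^ (s - 1)" if "j \<in> {1..r}" for j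
          using that by (meson not_le)
        then have "(\<Sum>j=1..r. real (card (sols s c (A j)))) < (\<Sum>j=1..r. \<kappa> / (2 * r) * real N ^ (s - 1))"
          using assms(4) by (intro sum_strict_mono) simp_all
        then show False using many assms(4) by simp
      qed
      then obtain j where j: "j \<in> {1..r}" "\<kappa> / (2 * r) * real N ^ (s - 1) \<le> card (sols s c (A j))" ..
      define X where "X = {- 2 * int N..2 * int N}"
      define T where "T = (\<Sum>x\<in>sols s c X. \<Prod>i=1..s. smooth B (C j) (x i))"
      \<comment> \<open>Since \<open>N = n ^ 2\<close>, the number of solutions is of order
        \<open>n ^ (2 * s - 2)\<close>, and each carries weight at least
        \<open>(1 / (2 * r * n)) ^ s\<close>.\<close>
      have "\<beta> * n ^ (s - 2) = \<kappa> / (2 * r) * real N ^ (s - 1) * (1 / (2 * r * n)) ^ s"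
      proof -
        have "real N ^ (s - 1) = n ^ (s - 2) * n ^ s"
          unfolding n(2)[symmetric] power_mult[symmetric] power_add[symmetric]
          using assms(1) by (intro arg_cong[where f = "\<lambda>i. n ^ i"]) simp
        then show ?thesis using n(1) by (simp add: \<beta>_def power_divide power_mult_distrib)
      qed
      also have "\<dots> \<le> card (sols s c (A j)) * (1 / (2 * r * n)) ^ s"
        using j(2) n(1) by (intro mult_right_mono) auto
      also have "\<dots> \<le> T" unfolding T_def
        using j(1) n(1) by (intro smooth_solutions_ge) (auto simp: X_def A_def)
      finally have T: "\<beta> * n ^ (s - 2) \<le> T" .
      have M: "4 * int N * (\<Sum>i=1..s. \<bar>c i\<bar>) < int (Q * N)"
        using N by (simp add: Q_def sum_nonneg algebra_simps)
      have "\<bar>card (sols s c (C j)) - T\<bar> \<le> 2 * real s ^ 2 * (\<epsilon> * n) * (2 * n) ^ (s - 3)"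
        unfolding T_def X_def
      proof (rule transference[OF S(2) CS[OF j(1)] _ BN assms(1) nz M])
        show "C j \<subseteq> {1..int N}" using CS[OF j(1)] S(1) by blast
        have "card (C j) \<le> card S" by (rule card_mono[OF finS CS[OF j(1)]])
        then show "card (C j) \<le> 2 * n" using cS by simp
      qed (use N Q H[OF j(1)] in auto)
      also have "\<dots> = \<beta> / 2 * n ^ (s - 2)"
      proof -
        have "s - 2 = Suc (s - 3)" using assms(1) by simp
        then show ?thesis using assms(1) by (simp add: \<epsilon>_def power_mult_distrib)
      qed
      finally have "\<beta> / 2 * n ^ (s - 2) \<le> card (sols s c (C j))" using T by linarith
      moreover have "\<beta> / 2 ^ (s + 1) * real (card S) ^ s / N \<le> \<beta> / 2 * n ^ (s - 2)"
      proof -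
        \<comment> \<open>The power of 2 compensates for \<open>card S \<le> 2 * n\<close>, and for
          the half lost to the transference error.\<close>
        have "\<beta> / 2 ^ (s + 1) * real (card S) ^ s / N \<le> \<beta> / 2 ^ (s + 1) * (2 * n) ^ s / N"
          using \<beta> cS by (intro divide_right_mono mult_left_mono power_mono) auto
        also have "\<beta> / 2 ^ (s + 1) * (2 * n) ^ s / N = \<beta> / 2 * n ^ (s - 2)"
        proof -
          have "s = (s - 2) + 2" using assms(1) by simp
          then have "n ^ s = n ^ (s - 2) * N" using n(2) by (metis power_add)
          then show ?thesis using N by (simp add: power_mult_distrib)
        qed
        finally show ?thesis .
      qed
      ultimately have "\<beta> / 2 ^ (s + 1) * real (card S) ^ s / N \<le> solution_sum s c (C j)"
        using solution_sum_eq_card[OF finite_subset[OF CS[OF j(1)] finS], of s c] by simp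
      then show ?thesis using j(1) by blast
    qed
    then show "real N \<le> max (real N\<^sub>1) (max 1 (\<nu> ^ 2)) \<or>
      \<gamma> / 32 * sqrt (real N) \<le> \<bar>real (card S) - sqrt (real N)\<bar> \<or>
      (\<forall>C. colouring r C S \<longrightarrow>
        (\<exists>j\<in>{1..r}. \<beta> / 2 ^ (s + 1) * real (card S) ^ s / real N \<le> solution_sum s c (C j)))"
      unfolding n_def by (meson not_le)
  qed (use \<gamma> \<beta> in auto)
qed

end
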